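(* Let $L$ be a $3$-Lie algebra over a field $\mathbb{k}$, let $X=\mathbb{k}\oplus L$ with coalgebra structure $$\Delta(a,x)=(a,x)\otimes(1,0)+(1,0)\otimes(0,x),\qquad \epsilon(a,x)=a,$$ and let $T:X\otimes X\otimes X\to X$ be the linear map $$T((a,x)\otimes(b,y)\otimes(c,z))=(abc,\ bcx+[x,y,z]).$$ Then the coalgebra $(X,\Delta,\epsilon)$ endowed with $T$ is a ternary self-distributive (TSD) object. Moreover, $T$ is reversible.
   Context: A $3$-Lie algebra over $\mathbb{k}$ is a $\mathbb{k}$-vector space $L$ with a trilinear map $[\cdot,\cdot,\cdot]:L^{\times 3}\to L$ such that $[x_1,x_2,x_3]=\mathrm{sgn}(\sigma)[x_{\sigma(1)},x_{\sigma(2)},x_{\sigma(3)}]$ for every permutation $\sigma$ of $\{1,2,3\}$, and $$[[x_1,x_2,x_3],x_4,x_5]=[[x_1,x_4,x_5],x_2,x_3]+[x_1,[x_2,x_4,x_5],x_3]+[x_1,x_2,[x_3,x_4,x_5]]$$ for all $x_i\in L$. Elements of $\mathbb{k}\oplus L$ are written as pairs $(a,x)$, $a\in\mathbb{k}$, $x\in L$; tensor products are over $\mathbb{k}$. Sweedler notation $\Delta(x)=x^{(1)}\otimes x^{(2)}$ and $(\Delta\otimes\mathbf 1)\Delta(x)=x^{(1)}\otimes x^{(2)}\otimes x^{(3)}$ is used. A coalgebra $(X,\Delta,\epsilon)$ with a coalgebra morphism $T:X^{\otimes 3}\to X$ (where $X^{\otimes 3}$ has the tensor product coalgebra structure) is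 a TSD object if for all $x,y,z,u,v\in X$ $$T(T(x\otimes y\otimes z)\otimes u\otimes v)=T\big(T(x\otimes u^{(1)}\otimes v^{(1)})\otimes T(y\otimes u^{(2)}\otimes v^{(2)})\otimes T(z\otimes u^{(3)}\otimes v^{(3)})\big).$$ A TSD object $(X,T)$ is reversible if there is a linear map $\tilde T:X^{\otimes 3}\to X$ such that $(X,\Delta,\tilde T)$ is a TSD object and, for all $x,y,z\in X$, $$\tilde T\big(T(x\otimes y^{(2)}\otimes z^{(2)})\otimes z^{(1)}\otimes y^{(1)}\big)=\epsilon(y)\epsilon(z)x,$$ together with the same equation with the roles of $T$ and $\tilde T$ exchanged. *)

theory Defs
  imports "Jordan_Normal_Form.Missing_VectorSpace" "HOL-Algebra.AbelCoset" "HOL-Combinatorics.Permutations"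
begin

section \<open>Tensor products of vector spaces\<close>

text \<open>
  Vector spaces are module records over a field record \<open>K\<close>, as in \<^locale>\<open>vectorspace\<close>; linear maps
  are the elements of \<^const>\<open>module_hom\<close>. The ring multiplication and unit that every module record
  carries are irrelevant and are filled with dummy values below, as in \<^const>\<open>direct_sum\<close>.
\<close>

definition self_module :: "('k, 'r) ring_scheme \<Rightarrow> ('k, 'k) module" where
  "self_module K = \<lparr>carrier = carrier K, mult = mult K, one = one K, zero = zero K, add = add K,
     smult = mult K\<rparr>"

text \<open>Finitely supported functions on \<open>S\<close>, extended by zero outside \<open>S\<close>.\<close>

definition free_vs :: "('k, 'r) ring_scheme \<Rightarrow> 's set \<Rightarrow> ('k, 's \<Rightarrow> 'k) module" where
  "free_vs K S = \<lparr>
     carrier = {f. (\<forall>s\<in>S. f s \<in> carrier K) \<and> (\<forall>s. s \<notin> S \<longrightarrow> f s = \<zero>\<^bsub>K\<^esub>) \<and> finite {s. f s \<noteq> \<zero>\<^bsub>K\<^esub>}},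
     mult = (\<lambda>f g s. \<zero>\<^bsub>K\<^esub>), one = (\<lambda>s. \<zero>\<^bsub>K\<^esub>), zero = (\<lambda>s. \<zero>\<^bsub>K\<^esub>),
     add = (\<lambda>f g s. f s \<oplus>\<^bsub>K\<^esub> g s), smult = (\<lambda>c f s. c \<otimes>\<^bsub>K\<^esub> f s)\<rparr>"

definition free_gen :: "('k, 'r) ring_scheme \<Rightarrow> 's \<Rightarrow> 's \<Rightarrow> 'k" where
  "free_gen K s = (\<lambda>t. if t = s then \<one>\<^bsub>K\<^esub> else \<zero>\<^bsub>K\<^esub>)"

definition quotient_vs :: "('k, 'v, 'n) module_scheme \<Rightarrow> 'v set \<Rightarrow> ('k, 'v set) module" where
  "quotient_vs V N = \<lparr>carrier = a_rcosets\<^bsub>V\<^esub> N, mult = (\<lambda>A B. N), one = N, zero = N,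
     add = set_add V, smult = (\<lambda>c A. \<Union>a\<in>A. N +>\<^bsub>V\<^esub> (c \<odot>\<^bsub>V\<^esub> a))\<rparr>"

definition tensor_rels ::
  "('k, 'r) ring_scheme \<Rightarrow> ('k, 'v, 'm) module_scheme \<Rightarrow> ('k, 'w, 'n) module_scheme \<Rightarrow> ('v \<times> 'w \<Rightarrow> 'k) set"
  where
  "tensor_rels K V W = (let F = free_vs K (carrier V \<times> carrier W); e = free_gen K in
     {e (x \<oplus>\<^bsub>V\<^esub> x', y) \<ominus>\<^bsub>F\<^esub> (e (x, y) \<oplus>\<^bsub>F\<^esub> e (x', y)) | x x' y.
        x \<in> carrier V \<and> x' \<in> carrier V \<and> y \<in> carrier W} \<union>
     {e (x, y \<oplus>\<^bsub>W\<^esub> y') \<ominus>\<^bsub>F\<^esub> (e (x, y) \<oplus>\<^bsub>F\<^esub> e (x, y')) | x y y'.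
        x \<in> carrier V \<and> y \<in> carrier W \<and> y' \<in> carrier W} \<union>
     {e (c \<odot>\<^bsub>V\<^esub> x, y) \<ominus>\<^bsub>F\<^esub> (c \<odot>\<^bsub>F\<^esub> e (x, y)) | c x y.
        c \<in> carrier K \<and> x \<in> carrier V \<and> y \<in> carrier W} \<union>
     {e (x, c \<odot>\<^bsub>W\<^esub> y) \<ominus>\<^bsub>F\<^esub> (c \<odot>\<^bsub>F\<^esub> e (x, y)) | c x y.
        c \<in> carrier K \<and> x \<in> carrier V \<and> y \<in> carrier W})"

definition tensor_null ::
  "('k, 'r) ring_scheme \<Rightarrow> ('k, 'v, 'm) module_scheme \<Rightarrow> ('k, 'w, 'n) module_scheme \<Rightarrow> ('v \<times> 'w \<Rightarrow> 'k) set"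
  where
  "tensor_null K V W = module.span K (free_vs K (carrier V \<times> carrier W)) (tensor_rels K V W)"

definition tensor ::
  "('k, 'r) ring_scheme \<Rightarrow> ('k, 'v, 'm) module_scheme \<Rightarrow> ('k, 'w, 'n) module_scheme \<Rightarrow>
     ('k, ('v \<times> 'w \<Rightarrow> 'k) set) module" where
  "tensor K V W = quotient_vs (free_vs K (carrier V \<times> carrier W)) (tensor_null K V W)"

definition tens ::
  "('k, 'r) ring_scheme \<Rightarrow> ('k, 'v, 'm) module_scheme \<Rightarrow> ('k, 'w, 'n) module_scheme \<Rightarrow>
     'v \<Rightarrow> 'w \<Rightarrow> ('v \<times> 'w \<Rightarrow> 'k) set" where
  "tens K V W x y = tensor_null K V W +>\<^bsub>free_vs K (carrier V \<times> carrier W)\<^esub> free_gen K (x, y)"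

text \<open>
  The linear map \<open>V \<otimes> W \<rightarrow> U\<close> induced by a bilinear map \<open>f\<close>; it exists and is unique by the universal
  property. Extensionality only fixes its values outside the carrier. For \<open>f\<close> not
  bilinear the value is unspecified.
\<close>

definition tensor_lift ::
  "('k, 'r) ring_scheme \<Rightarrow> ('k, 'v, 'm) module_scheme \<Rightarrow> ('k, 'w, 'n) module_scheme \<Rightarrow>
     ('k, 'u, 'p) module_scheme \<Rightarrow> ('v \<Rightarrow> 'w \<Rightarrow> 'u) \<Rightarrow> ('v \<times> 'w \<Rightarrow> 'k) set \<Rightarrow> 'u" where
  "tensor_lift K V W U f = (THE F. F \<in> module_hom K (tensor K V W) U \<and>
     F \<in> extensional (carrier (tensor K V W)) \<and>
     (\<forall>x\<in>carrier V. \<forall>y\<in>carrier W. F (tens K V W x y) = f x y))"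

definition tensor_map ::
  "('k, 'r) ring_scheme \<Rightarrow> ('k, 'v, 'm) module_scheme \<Rightarrow> ('k, 'w, 'n) module_scheme \<Rightarrow>
     ('k, 'v1, 'm1) module_scheme \<Rightarrow> ('k, 'w1, 'n1) module_scheme \<Rightarrow>
     ('v \<Rightarrow> 'v1) \<Rightarrow> ('w \<Rightarrow> 'w1) \<Rightarrow> ('v \<times> 'w \<Rightarrow> 'k) set \<Rightarrow> ('v1 \<times> 'w1 \<Rightarrow> 'k) set" where
  "tensor_map K V W V' W' f g =
     tensor_lift K V W (tensor K V' W') (\<lambda>x y. tens K V' W' (f x) (g y))"

text \<open>The associator \<open>(U \<otimes> V) \<otimes> W \<rightarrow> U \<otimes> (V \<otimes> W)\<close>.\<close>

definition tensor_assoc ::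
  "('k, 'r) ring_scheme \<Rightarrow> ('k, 'u, 'p) module_scheme \<Rightarrow> ('k, 'v, 'm) module_scheme \<Rightarrow>
     ('k, 'w, 'n) module_scheme \<Rightarrow>
     (('u \<times> 'v \<Rightarrow> 'k) set \<times> 'w \<Rightarrow> 'k) set \<Rightarrow> ('u \<times> ('v \<times> 'w \<Rightarrow> 'k) set \<Rightarrow> 'k) set" where
  "tensor_assoc K U V W = (let A = tensor K U (tensor K V W) in
     tensor_lift K (tensor K U V) W A
       (\<lambda>s z. tensor_lift K U V A (\<lambda>x y. tens K U (tensor K V W) x (tens K V W y z)) s))"

text \<open>The middle interchange \<open>(U \<otimes> V) \<otimes> (U' \<otimes> V') \<rightarrow> (U \<otimes> U') \<otimes> (V \<otimes> V')\<close>.\<close>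

definition tensor_interchange ::
  "('k, 'r) ring_scheme \<Rightarrow> ('k, 'u, 'p) module_scheme \<Rightarrow> ('k, 'v, 'm) module_scheme \<Rightarrow>
     ('k, 'u1, 'p1) module_scheme \<Rightarrow> ('k, 'v1, 'm1) module_scheme \<Rightarrow>
     (('u \<times> 'v \<Rightarrow> 'k) set \<times> ('u1 \<times> 'v1 \<Rightarrow> 'k) set \<Rightarrow> 'k) set \<Rightarrow>
     (('u \<times> 'u1 \<Rightarrow> 'k) set \<times> ('v \<times> 'v1 \<Rightarrow> 'k) set \<Rightarrow> 'k) set" where
  "tensor_interchange K U V U' V' = (let A = tensor K (tensor K U U') (tensor K V V') in
     tensor_lift K (tensor K U V) (tensor K U' V') A
       (\<lambda>s t. tensor_lift K U V A
         (\<lambda>u v. tensor_lift K U' V' A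
           (\<lambda>u' v'. tens K (tensor K U U') (tensor K V V') (tens K U U' u u') (tens K V V' v v')) t) s))"

text \<open>The convention for threefold tensor powers is \<open>(V \<otimes> V) \<otimes> V\<close>.\<close>

definition tensor3 ::
  "('k, 'r) ring_scheme \<Rightarrow> ('k, 'v, 'm) module_scheme \<Rightarrow> ('k, (('v \<times> 'v \<Rightarrow> 'k) set \<times> 'v \<Rightarrow> 'k) set) module"
  where "tensor3 K V = tensor K (tensor K V V) V"

definition tens3 ::
  "('k, 'r) ring_scheme \<Rightarrow> ('k, 'v, 'm) module_scheme \<Rightarrow>
     'v \<Rightarrow> 'v \<Rightarrow> 'v \<Rightarrow> (('v \<times> 'v \<Rightarrow> 'k) set \<times> 'v \<Rightarrow> 'k) set"
  where "tens3 K V x y z = tens K (tensor K V V) V (tens K V V x y) z"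


section \<open>Coalgebras\<close>

record ('k, 'v) coalgebra = "('k, 'v) module" +
  comult :: "'v \<Rightarrow> ('v \<times> 'v \<Rightarrow> 'k) set"
  counit :: "'v \<Rightarrow> 'k"

definition comult3 ::
  "('k, 'r) ring_scheme \<Rightarrow> ('k, 'v, 'm) coalgebra_scheme \<Rightarrow>
     'v \<Rightarrow> (('v \<times> 'v \<Rightarrow> 'k) set \<times> 'v \<Rightarrow> 'k) set" where
  "comult3 K C c = tensor_map K C C (tensor K C C) C (comult C) (\<lambda>x. x) (comult C c)"

locale coalgebra = vectorspace K C
  for K :: "('k, 'r) ring_scheme" and C :: "('k, 'v, 'm) coalgebra_scheme" +
  assumes comult_linear: "comult C \<in> module_hom K C (tensor K C C)"
    and counit_linear: "counit C \<in> module_hom K C (self_module K)"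
    and coassoc: "c \<in> carrier C \<Longrightarrow>
      tensor_assoc K C C C (comult3 K C c) =
        tensor_map K C C C (tensor K C C) (\<lambda>x. x) (comult C) (comult C c)"
    and counit_left: "c \<in> carrier C \<Longrightarrow>
      tensor_lift K C C C (\<lambda>x y. counit C x \<odot>\<^bsub>C\<^esub> y) (comult C c) = c"
    and counit_right: "c \<in> carrier C \<Longrightarrow>
      tensor_lift K C C C (\<lambda>x y. counit C y \<odot>\<^bsub>C\<^esub> x) (comult C c) = c"

definition tensor_coalgebra ::
  "('k, 'r) ring_scheme \<Rightarrow> ('k, 'v, 'm) coalgebra_scheme \<Rightarrow> ('k, 'w, 'n) coalgebra_scheme \<Rightarrow>
     ('k, ('v \<times> 'w \<Rightarrow> 'k) set) coalgebra" where
  "tensor_coalgebra K C D = module.extend (tensor K C D) (coalgebra.fields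
     (\<lambda>t. tensor_interchange K C C D D
        (tensor_map K C D (tensor K C C) (tensor K D D) (comult C) (comult D) t))
     (tensor_lift K C D (self_module K) (\<lambda>c d. counit C c \<otimes>\<^bsub>K\<^esub> counit D d)))"

definition coalgebra_hom ::
  "('k, 'r) ring_scheme \<Rightarrow> ('k, 'v, 'm) coalgebra_scheme \<Rightarrow> ('k, 'w, 'n) coalgebra_scheme \<Rightarrow>
     ('v \<Rightarrow> 'w) set" where
  "coalgebra_hom K C D = {F \<in> module_hom K C D. \<forall>c\<in>carrier C.
     comult D (F c) = tensor_map K C C D D F F (comult C c) \<and> counit D (F c) = counit C c}"

text \<open>
  Sweedler notation: for \<open>f\<close> multilinear on \<open>C\<close> with values in \<open>U\<close>, \<open>sweedler K C U f c\<close> is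
  the value of the linear extension of \<open>f\<close> at \<open>\<Delta>(c)\<close>, and \<open>sweedler3 K C U f c\<close> that at
  \<open>(\<Delta> \<otimes> 1)\<Delta>(c)\<close>.
\<close>

definition sweedler ::
  "('k, 'r) ring_scheme \<Rightarrow> ('k, 'v, 'm) coalgebra_scheme \<Rightarrow> ('k, 'u, 'p) module_scheme \<Rightarrow>
     ('v \<Rightarrow> 'v \<Rightarrow> 'u) \<Rightarrow> 'v \<Rightarrow> 'u" where
  "sweedler K C U f c = tensor_lift K C C U f (comult C c)"

definition sweedler3 ::
  "('k, 'r) ring_scheme \<Rightarrow> ('k, 'v, 'm) coalgebra_scheme \<Rightarrow> ('k, 'u, 'p) module_scheme \<Rightarrow>
     ('v \<Rightarrow> 'v \<Rightarrow> 'v \<Rightarrow> 'u) \<Rightarrow> 'v \<Rightarrow> 'u" where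
  "sweedler3 K C U f c = tensor_lift K (tensor K C C) C U
     (\<lambda>s c3. tensor_lift K C C U (\<lambda>c1 c2. f c1 c2 c3) s) (comult3 K C c)"


section \<open>Ternary self-distributive objects\<close>

locale tsd_object = coalgebra K C
  for K :: "('k, 'r) ring_scheme" and C :: "('k, 'v, 'm) coalgebra_scheme" +
  fixes T :: "(('v \<times> 'v \<Rightarrow> 'k) set \<times> 'v \<Rightarrow> 'k) set \<Rightarrow> 'v"
  assumes coalgebra_hom:
      "T \<in> coalgebra_hom K (tensor_coalgebra K (tensor_coalgebra K C C) C) C"
    and self_distributive:
      "\<lbrakk>x \<in> carrier C; y \<in> carrier C; z \<in> carrier C; u \<in> carrier C; v \<in> carrier C\<rbrakk> \<Longrightarrow>
        T (tens3 K C (T (tens3 K C x y z)) u v) =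
        sweedler3 K C C (\<lambda>u1 u2 u3. sweedler3 K C C (\<lambda>v1 v2 v3.
          T (tens3 K C (T (tens3 K C x u1 v1)) (T (tens3 K C y u2 v2)) (T (tens3 K C z u3 v3)))) v) u"

definition tsd_left_inverse ::
  "('k, 'r) ring_scheme \<Rightarrow> ('k, 'v, 'm) coalgebra_scheme \<Rightarrow>
     ((('v \<times> 'v \<Rightarrow> 'k) set \<times> 'v \<Rightarrow> 'k) set \<Rightarrow> 'v) \<Rightarrow>
     ((('v \<times> 'v \<Rightarrow> 'k) set \<times> 'v \<Rightarrow> 'k) set \<Rightarrow> 'v) \<Rightarrow> bool" where
  "tsd_left_inverse K C T' T \<longleftrightarrow>
     (\<forall>x\<in>carrier C. \<forall>y\<in>carrier C. \<forall>z\<in>carrier C.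
        sweedler K C C (\<lambda>y1 y2. sweedler K C C (\<lambda>z1 z2.
          T' (tens3 K C (T (tens3 K C x y2 z2)) z1 y1)) z) y =
        (counit C y \<otimes>\<^bsub>K\<^esub> counit C z) \<odot>\<^bsub>C\<^esub> x)"

definition reversible_tsd ::
  "('k, 'r) ring_scheme \<Rightarrow> ('k, 'v, 'm) coalgebra_scheme \<Rightarrow>
     ((('v \<times> 'v \<Rightarrow> 'k) set \<times> 'v \<Rightarrow> 'k) set \<Rightarrow> 'v) \<Rightarrow> bool" where
  "reversible_tsd K C T \<longleftrightarrow> tsd_object K C T \<and>
     (\<exists>T'. T' \<in> module_hom K (tensor3 K C) C \<and> tsd_object K C T' \<and>
        tsd_left_inverse K C T' T \<and> tsd_left_inverse K C T T')"


section \<open>3-Lie algebras and the associated coalgebra\<close>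

locale three_lie_algebra = vectorspace K L
  for K :: "('k, 'r) ring_scheme" and L :: "('k, 'l, 'm) module_scheme" +
  fixes br :: "'l \<Rightarrow> 'l \<Rightarrow> 'l \<Rightarrow> 'l"
  assumes linear1: "\<lbrakk>y \<in> carrier L; z \<in> carrier L\<rbrakk> \<Longrightarrow> (\<lambda>x. br x y z) \<in> module_hom K L L"
    and linear2: "\<lbrakk>x \<in> carrier L; z \<in> carrier L\<rbrakk> \<Longrightarrow> (\<lambda>y. br x y z) \<in> module_hom K L L"
    and linear3: "\<lbrakk>x \<in> carrier L; y \<in> carrier L\<rbrakk> \<Longrightarrow> (\<lambda>z. br x y z) \<in> module_hom K L L"
    and skew: "\<lbrakk>\<And>i. i \<in> {1, 2, 3 :: nat} \<Longrightarrow> w i \<in> carrier L; \<sigma> permutes {1, 2, 3 :: nat}\<rbrakk> \<Longrightarrow>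
      br (w 1) (w 2) (w 3) = [sign \<sigma>] \<cdot>\<^bsub>L\<^esub> br (w (\<sigma> 1)) (w (\<sigma> 2)) (w (\<sigma> 3))"
    and fundamental_identity:
      "\<lbrakk>x1 \<in> carrier L; x2 \<in> carrier L; x3 \<in> carrier L; x4 \<in> carrier L; x5 \<in> carrier L\<rbrakk> \<Longrightarrow>
        br (br x1 x2 x3) x4 x5 =
          br (br x1 x4 x5) x2 x3 \<oplus>\<^bsub>L\<^esub> br x1 (br x2 x4 x5) x3 \<oplus>\<^bsub>L\<^esub> br x1 x2 (br x3 x4 x5)"

definition three_lie_coalgebra ::
  "('k, 'r) ring_scheme \<Rightarrow> ('k, 'l, 'm) module_scheme \<Rightarrow> ('k, 'k \<times> 'l) coalgebra" where
  "three_lie_coalgebra K L = (let X = direct_sum (self_module K) L in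
     module.extend X (coalgebra.fields
       (\<lambda>(a, x). tens K X X (a, x) (\<one>\<^bsub>K\<^esub>, \<zero>\<^bsub>L\<^esub>) \<oplus>\<^bsub>tensor K X X\<^esub> tens K X X (\<one>\<^bsub>K\<^esub>, \<zero>\<^bsub>L\<^esub>) (\<zero>\<^bsub>K\<^esub>, x))
       (\<lambda>(a, x). a)))"

definition is_three_lie_op ::
  "('k, 'r) ring_scheme \<Rightarrow> ('k, 'l, 'm) module_scheme \<Rightarrow> ('l \<Rightarrow> 'l \<Rightarrow> 'l \<Rightarrow> 'l) \<Rightarrow>
     (((('k \<times> 'l) \<times> ('k \<times> 'l) \<Rightarrow> 'k) set \<times> ('k \<times> 'l) \<Rightarrow> 'k) set \<Rightarrow> 'k \<times> 'l) \<Rightarrow> bool" where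
  "is_three_lie_op K L br T \<longleftrightarrow> (let X = three_lie_coalgebra K L in
     T \<in> module_hom K (tensor3 K X) X \<and>
     (\<forall>a\<in>carrier K. \<forall>b\<in>carrier K. \<forall>c\<in>carrier K.
      \<forall>x\<in>carrier L. \<forall>y\<in>carrier L. \<forall>z\<in>carrier L.
        T (tens3 K X (a, x) (b, y) (c, z)) =
          (a \<otimes>\<^bsub>K\<^esub> b \<otimes>\<^bsub>K\<^esub> c, (b \<otimes>\<^bsub>K\<^esub> c) \<odot>\<^bsub>L\<^esub> x \<oplus>\<^bsub>L\<^esub> br x y z)))"

end

theory Submission
  imports Defs
begin

text \<open>
  Write \<open>i = (1,0)\<close> and \<open>p (a,x) = (0,x)\<close>, so that \<open>\<Delta> c = c \<otimes> i + i \<otimes> p c\<close> and \<open>p i = 0\<close>. A Sweedler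
  expression in \<open>c\<close> is then a sum of two (or three) terms in which \<open>c\<close> or \<open>p c\<close> occupies one slot
  and \<open>i\<close> the others. For \<open>t x y z = T (x \<otimes> y \<otimes> z)\<close> one has \<open>t x i i = x\<close> and
  \<open>t x i (p z) = t x (p y) i = 0\<close>, so most terms vanish. What remains of self-distributivity is
  \<open>t (t x y z) u v = t (t x u v) y z + t x (t y (p u) (p v)) z + t x y (t z (p u) (p v))\<close>,
  which is the fundamental identity, and what remains of reversibility with inverse \<open>T\<close> itself is
  \<open>t x z y + t x (p y) (p z) = \<epsilon>(y) \<epsilon>(z) x\<close>, which is skew-symmetry in the last two arguments.
\<close>

section \<open>Module homomorphisms\<close>

text \<open>\<open>tensor_lift\<close> is a definite description whose value is unspecified unless
  its argument is bilinear. A Sweedler expression can therefore be expanded only after its summand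
  is known to be multilinear, and in a nested one the inner lift must also depend linearly on the
  outer variables. This is why the universal property and the linearity of lifts in parameters are
  established for module records before any coalgebra appears. The identities for \<open>T\<close>
  are then derived from abstract properties of \<open>i\<close>, \<open>p\<close> and
  \<open>t\<close>; pairs and brackets enter only when those properties are checked. That
  \<open>T\<close> can be its own inverse may look surprising: with unit weights it acts on L as 1 +
  D, where D = \<open>[_,y,z]\<close>, exchanging y and z gives 1 - D, and the composite is 1 - D^2.
  The coproduct removes the square. It puts the non-unit part of an argument into one tensor factor
  at a time, so no term carries two brackets; the single brackets remain, with opposite
  signs.\<close>

lemma module_homI:
  assumes "\<And>x. x \<in> carrier M \<Longrightarrow> f x \<in> carrier N"
    and "\<And>x y. x \<in> carrier M \<Longrightarrow> y \<in> carrier M \<Longrightarrow> f (x \<oplus>\<^bsub>M\<^esub> y) = f x \<oplus>\<^bsub>N\<^esub> f y"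
    and "\<And>c x. c \<in> carrier R \<Longrightarrow> x \<in> carrier M \<Longrightarrow> f (c \<odot>\<^bsub>M\<^esub> x) = c \<odot>\<^bsub>N\<^esub> f x"
  shows "f \<in> module_hom R M N"
  using assms by (auto simp: module_hom_def)

lemma module_hom_mem: "f \<in> module_hom R M N \<Longrightarrow> x \<in> carrier M \<Longrightarrow> f x \<in> carrier N"
  by (auto simp: module_hom_def)

lemma module_hom_zero:
  assumes "module R M" "module R N" "f \<in> module_hom R M N"
  shows "f \<zero>\<^bsub>M\<^esub> = \<zero>\<^bsub>N\<^esub>"
proof -
  interpret mod_hom R M N f
    using assms by (simp add: mod_hom_def mod_hom_axioms_def)
  show ?thesis by simp
qed

lemma module_hom_id: "(\<lambda>x. x) \<in> module_hom R M M"
  by (auto simp: module_hom_def)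

lemma module_hom_compose:
  assumes "f \<in> module_hom R M N" "g \<in> module_hom R N P"
  shows "(\<lambda>x. g (f x)) \<in> module_hom R M P"
  using assms by (intro module_homI) (auto simp: module_hom_mem module_hom_add module_hom_smult)

lemma (in module) module_hom_sum:
  assumes "f \<in> module_hom R P M" "g \<in> module_hom R P M"
  shows "(\<lambda>x. f x \<oplus>\<^bsub>M\<^esub> g x) \<in> module_hom R P M"
proof (rule module_homI)
  fix x y assume "x \<in> carrier P" "y \<in> carrier P"
  with assms show "f (x \<oplus>\<^bsub>P\<^esub> y) \<oplus>\<^bsub>M\<^esub> g (x \<oplus>\<^bsub>P\<^esub> y) = f x \<oplus>\<^bsub>M\<^esub> g x \<oplus>\<^bsub>M\<^esub> (f y \<oplus>\<^bsub>M\<^esub> g y)"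
    by (simp add: module_hom_add module_hom_mem M.a_ac)
qed (use assms in \<open>auto simp: module_hom_mem module_hom_smult smult_r_distr\<close>)

text \<open>The module axioms speak about these four fields, so they pass between records of
  different types. A coalgebra record is a plain module record with fields added, and gets its
  module structure this way.\<close>

lemma module_cong:
  assumes "module R M" "carrier N = carrier M" "add N = add M" "zero N = zero M" "smult N = smult M"
  shows "module R N"
proof -
  interpret module R M by fact
  have "\<exists>y\<in>carrier N. x \<oplus>\<^bsub>N\<^esub> y = \<zero>\<^bsub>N\<^esub>" if "x \<in> carrier N" for x
    using that assms(2-) by (intro bexI[of _ "\<ominus>\<^bsub>M\<^esub> x"]) (auto simp: M.r_neg)
  then show ?thesis
    using assms(2-) R.is_cring
    by (intro module_criteria)
      (auto simp: M.a_ac smult_assoc1 smult_l_distr smult_r_distr)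
qed

section \<open>Quotient modules\<close>

text \<open>A submodule is closed under sums, zero and scalars by definition; negatives come from -x
  = (-1) x. The conclusion makes the coset calculus of abelian groups available for
  quotients.\<close>

lemma submodule_imp_abelian_subgroup:
  assumes "submodule R N M"
  shows "abelian_subgroup N M"
proof -
  interpret N: submodule R N M by fact
  interpret module R M by (rule N.module)
  have "\<ominus>\<^bsub>M\<^esub> x \<in> N" if "x \<in> N" for x
  proof -
    have "x \<in> carrier M" using that N.subset by blast
    moreover have "(\<ominus>\<^bsub>R\<^esub> \<one>\<^bsub>R\<^esub>) \<odot>\<^bsub>M\<^esub> x \<in> N"
      using that by (intro N.smult_closed) auto
    ultimately show ?thesis
      by (simp only: smult_minus_1)
  qed
  moreover have "inv\<^bsub>add_monoid M\<^esub> x = \<ominus>\<^bsub>M\<^esub> x" for x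
    by (simp add: a_inv_def)
  ultimately have "subgroup N (add_monoid M)"
    using N.subset N.m_closed N.zero_closed by (intro subgroup.intro) simp_all
  then show ?thesis
    by (intro abelian_subgroupI3 additive_subgroup.intro M.abelian_group_axioms)
qed

lemma quotient_vs_sel:
  "carrier (quotient_vs M N) = (\<lambda>x. N +>\<^bsub>M\<^esub> x) ` carrier M"
  "zero (quotient_vs M N) = N"
  "add (quotient_vs M N) = set_add M"
  by (auto simp: quotient_vs_def A_RCOSETS_def')

text \<open>The scalar action on the quotient is defined as a union over all representatives
  \<open>a\<close> of a coset. Two representatives differ by an element of \<open>N\<close>, and so
  do their multiples by \<open>c\<close>; all members of the union are thus one coset, and the union
  is not empty because the coset contains \<open>x\<close>.\<close>

lemma quotient_vs_smult:
  assumes "submodule R N M" "c \<in> carrier R" "x \<in> carrier M"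
  shows "c \<odot>\<^bsub>quotient_vs M N\<^esub> (N +>\<^bsub>M\<^esub> x) = N +>\<^bsub>M\<^esub> (c \<odot>\<^bsub>M\<^esub> x)"
proof -
  interpret N: submodule R N M by fact
  interpret module R M by (rule N.module)
  interpret A: abelian_subgroup N M by (rule submodule_imp_abelian_subgroup) fact
  have *: "N +>\<^bsub>M\<^esub> (c \<odot>\<^bsub>M\<^esub> a) = N +>\<^bsub>M\<^esub> (c \<odot>\<^bsub>M\<^esub> x)" if a: "a \<in> N +>\<^bsub>M\<^esub> x" for a
  proof -
    have aM: "a \<in> carrier M" using A.a_elemrcos_carrier assms(3) a by blast
    have "a \<oplus>\<^bsub>M\<^esub> \<ominus>\<^bsub>M\<^esub> x \<in> N" using A.a_rcos_module_imp assms(3) a by blast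
    then have "c \<odot>\<^bsub>M\<^esub> (a \<oplus>\<^bsub>M\<^esub> \<ominus>\<^bsub>M\<^esub> x) \<in> N" using assms(2) by blast
    then have "c \<odot>\<^bsub>M\<^esub> a \<oplus>\<^bsub>M\<^esub> \<ominus>\<^bsub>M\<^esub> (c \<odot>\<^bsub>M\<^esub> x) \<in> N"
      using assms(2,3) aM by (simp add: smult_r_distr smult_r_minus)
    then have "c \<odot>\<^bsub>M\<^esub> a \<in> N +>\<^bsub>M\<^esub> (c \<odot>\<^bsub>M\<^esub> x)"
      using assms(2,3) aM by (intro A.a_rcos_module_rev) auto
    then show ?thesis
      using assms(2,3) by (metis A.a_repr_independence' smult_closed)
  qed
  have "c \<odot>\<^bsub>quotient_vs M N\<^esub> (N +>\<^bsub>M\<^esub> x) = (\<Union>a\<in>N +>\<^bsub>M\<^esub> x. N +>\<^bsub>M\<^esub> (c \<odot>\<^bsub>M\<^esub> a))"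
    by (simp add: quotient_vs_def)
  also have "\<dots> = (\<Union>a\<in>N +>\<^bsub>M\<^esub> x. N +>\<^bsub>M\<^esub> (c \<odot>\<^bsub>M\<^esub> x))"
    by (rule SUP_cong[OF refl *])
  also have "\<dots> = N +>\<^bsub>M\<^esub> (c \<odot>\<^bsub>M\<^esub> x)"
    using A.a_rcos_self[OF assms(3)] by (intro UN_constant_eq) blast+
  finally show ?thesis .
qed

lemma quotient_vs_proj_hom:
  assumes "submodule R N M"
  shows "(\<lambda>x. N +>\<^bsub>M\<^esub> x) \<in> module_hom R M (quotient_vs M N)"
proof -
  interpret A: abelian_subgroup N M by (rule submodule_imp_abelian_subgroup) fact
  show ?thesis
    by (rule module_homI) (auto simp: quotient_vs_sel quotient_vs_smult[OF assms] A.a_rcos_sum)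
qed

lemma module_quotient_vs:
  assumes "submodule R N M"
  shows "module R (quotient_vs M N)"
proof -
  let ?Q = "quotient_vs M N"
  interpret N: submodule R N M by fact
  interpret module R M by (rule N.module)
  interpret A: abelian_subgroup N M by (rule submodule_imp_abelian_subgroup) fact
  have add: "(N +>\<^bsub>M\<^esub> x) \<oplus>\<^bsub>?Q\<^esub> (N +>\<^bsub>M\<^esub> y) = N +>\<^bsub>M\<^esub> (x \<oplus>\<^bsub>M\<^esub> y)"
    if "x \<in> carrier M" "y \<in> carrier M" for x y
    using that by (simp add: quotient_vs_sel A.a_rcos_sum)
  have zero: "\<zero>\<^bsub>?Q\<^esub> = N +>\<^bsub>M\<^esub> \<zero>\<^bsub>M\<^esub>"
    by (simp add: quotient_vs_sel N.subset)
  have neg: "\<exists>w\<in>carrier ?Q. (N +>\<^bsub>M\<^esub> x) \<oplus>\<^bsub>?Q\<^esub> w = \<zero>\<^bsub>?Q\<^esub>" if "x \<in> carrier M" for x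
    using that by (intro bexI[of _ "N +>\<^bsub>M\<^esub> (\<ominus>\<^bsub>M\<^esub> x)"]) (simp_all add: add zero M.r_neg, simp add: quotient_vs_sel)
  show ?thesis
    using R.is_cring neg
    by (intro module_criteria)
      (auto simp: quotient_vs_sel(1) quotient_vs_smult[OF assms] zero add M.a_ac
        smult_assoc1 smult_l_distr smult_r_distr)
qed

section \<open>Free modules\<close>

lemma free_vs_sel:
  "zero (free_vs K S) = (\<lambda>s. \<zero>\<^bsub>K\<^esub>)"
  "add (free_vs K S) f g = (\<lambda>s. f s \<oplus>\<^bsub>K\<^esub> g s)"
  "smult (free_vs K S) c f = (\<lambda>s. c \<otimes>\<^bsub>K\<^esub> f s)"
  by (simp_all add: free_vs_def)

lemma carrier_free_vs:
  "f \<in> carrier (free_vs K S) \<longleftrightarrow>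
     (\<forall>s\<in>S. f s \<in> carrier K) \<and> (\<forall>s. s \<notin> S \<longrightarrow> f s = \<zero>\<^bsub>K\<^esub>) \<and> finite {s. f s \<noteq> \<zero>\<^bsub>K\<^esub>}"
  by (simp add: free_vs_def)

context cring
begin

lemma free_vs_mem: "f \<in> carrier (free_vs R S) \<Longrightarrow> f s \<in> carrier R"
  by (cases "s \<in> S") (auto simp: carrier_free_vs)

lemma free_vs_add_closed:
  assumes "f \<in> carrier (free_vs R S)" "g \<in> carrier (free_vs R S)"
  shows "f \<oplus>\<^bsub>free_vs R S\<^esub> g \<in> carrier (free_vs R S)"
proof -
  have "finite ({s. f s \<noteq> \<zero>} \<union> {s. g s \<noteq> \<zero>})"
    using assms by (simp add: carrier_free_vs)
  then have "finite {s. f s \<oplus> g s \<noteq> \<zero>}"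
    by (rule rev_finite_subset) auto
  then show ?thesis
    using assms by (auto simp: carrier_free_vs free_vs_sel)
qed

lemma free_vs_smult_closed:
  assumes "c \<in> carrier R" "f \<in> carrier (free_vs R S)"
  shows "c \<odot>\<^bsub>free_vs R S\<^esub> f \<in> carrier (free_vs R S)"
proof -
  have "finite {s. c \<otimes> f s \<noteq> \<zero>}"
    by (rule finite_subset[of _ "{s. f s \<noteq> \<zero>}"]) (use assms in \<open>auto simp: carrier_free_vs\<close>)
  then show ?thesis
    using assms by (auto simp: carrier_free_vs free_vs_sel)
qed

lemma module_free_vs: "module R (free_vs R S)"
proof -
  have neg: "\<exists>g\<in>carrier (free_vs R S). f \<oplus>\<^bsub>free_vs R S\<^esub> g = \<zero>\<^bsub>free_vs R S\<^esub>"
    if "f \<in> carrier (free_vs R S)" for f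
  proof (rule bexI)
    \<comment> \<open>The negative is taken as the multiple by -1, whose membership in the carrier
      follows from closure under scalars.\<close>
    show "f \<oplus>\<^bsub>free_vs R S\<^esub> ((\<ominus> \<one>) \<odot>\<^bsub>free_vs R S\<^esub> f) = \<zero>\<^bsub>free_vs R S\<^esub>"
      using free_vs_mem[OF that] by (simp add: free_vs_sel l_minus r_neg)
  qed (rule free_vs_smult_closed, use that in simp_all)
  show ?thesis
  proof (rule module_criteria)
    show "\<forall>f g. f \<in> carrier (free_vs R S) \<and> g \<in> carrier (free_vs R S) \<longrightarrow>
        f \<oplus>\<^bsub>free_vs R S\<^esub> g \<in> carrier (free_vs R S)"
      using free_vs_add_closed by blast
    show "\<forall>c f. c \<in> carrier R \<and> f \<in> carrier (free_vs R S) \<longrightarrow>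
        c \<odot>\<^bsub>free_vs R S\<^esub> f \<in> carrier (free_vs R S)"
      using free_vs_smult_closed by blast
    show "\<zero>\<^bsub>free_vs R S\<^esub> \<in> carrier (free_vs R S)"
      by (simp add: carrier_free_vs free_vs_sel)
  qed (use neg is_cring in \<open>auto simp: free_vs_mem a_ac m_assoc l_distr r_distr free_vs_sel\<close>)
qed

lemma free_gen_mem: "s \<in> S \<Longrightarrow> free_gen R s \<in> carrier (free_vs R S)"
  by (auto simp: carrier_free_vs free_gen_def)

text \<open>Induction on a finite set \<open>A\<close> containing the support, with the claim made
  for all functions supported in \<open>A\<close> at once.\<close>

lemma free_vs_induct [consumes 1, case_names zero add]:
  assumes f: "f \<in> carrier (free_vs R S)"
    and zero: "P \<zero>\<^bsub>free_vs R S\<^esub>"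
    and add: "\<And>f c s. \<lbrakk>f \<in> carrier (free_vs R S); P f; c \<in> carrier R; s \<in> S\<rbrakk> \<Longrightarrow>
      P (f \<oplus>\<^bsub>free_vs R S\<^esub> (c \<odot>\<^bsub>free_vs R S\<^esub> free_gen R s))"
  shows "P f"
proof -
  have "\<forall>f\<in>carrier (free_vs R S). {s. f s \<noteq> \<zero>} \<subseteq> A \<longrightarrow> P f" if "finite A" "A \<subseteq> S" for A
    using that
  proof (induction A rule: finite_induct)
    case empty
    have "f = \<zero>\<^bsub>free_vs R S\<^esub>" if "{s. f s \<noteq> \<zero>} \<subseteq> {}" for f
      using that by (auto simp: free_vs_sel)
    with zero show ?case by blast
  next
    case (insert a A)
    show ?case
    proof (intro ballI impI)
      fix f assume f: "f \<in> carrier (free_vs R S)" and supp: "{s. f s \<noteq> \<zero>} \<subseteq> insert a A"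
      \<comment> \<open>Erasing the value at \<open>a\<close> moves the support into
        \<open>A\<close>; what is erased is one multiple of a generator.\<close>
      define g where "g = f(a := \<zero>)"
      have "finite {s. g s \<noteq> \<zero>}"
        by (rule finite_subset[of _ "{s. f s \<noteq> \<zero>}"]) (use f in \<open>auto simp: g_def carrier_free_vs\<close>)
      then have g: "g \<in> carrier (free_vs R S)"
        using f by (auto simp: carrier_free_vs g_def)
      have "{s. g s \<noteq> \<zero>} \<subseteq> A"
        using supp by (auto simp: g_def)
      with insert g have "P g" by blast
      moreover have "f = g \<oplus>\<^bsub>free_vs R S\<^esub> (f a \<odot>\<^bsub>free_vs R S\<^esub> free_gen R a)"
        using free_vs_mem[OF f] by (auto simp: g_def free_vs_sel free_gen_def)
      ultimately show "P f"
        using add[of g "f a" a] g insert.prems free_vs_mem[OF f] by auto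
    qed
  qed
  moreover have "finite {s. f s \<noteq> \<zero>}" "{s. f s \<noteq> \<zero>} \<subseteq> S"
    using f by (auto simp: carrier_free_vs)
  ultimately show ?thesis
    using f by blast
qed

end

definition free_lift ::
  "('k, 'r) ring_scheme \<Rightarrow> ('k, 'u, 'p) module_scheme \<Rightarrow> ('s \<Rightarrow> 'u) \<Rightarrow> ('s \<Rightarrow> 'k) \<Rightarrow> 'u" where
  "free_lift K U h f = (\<Oplus>\<^bsub>U\<^esub>s\<in>{s. f s \<noteq> \<zero>\<^bsub>K\<^esub>}. f s \<odot>\<^bsub>U\<^esub> h s)"

text \<open>Supports vary with the function. Padding with zero terms lets the sums for
  \<open>f\<close>, \<open>g\<close> and their sum run over one common finite set, from which
  linearity follows termwise.\<close>

lemma (in module) free_lift_superset: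
  assumes "h \<in> S \<rightarrow> carrier M" "f \<in> carrier (free_vs R S)"
    and "finite A" "{s. f s \<noteq> \<zero>} \<subseteq> A" "A \<subseteq> S"
  shows "free_lift R M h f = (\<Oplus>\<^bsub>M\<^esub>s\<in>A. f s \<odot>\<^bsub>M\<^esub> h s)"
  unfolding free_lift_def
  by (rule M.add.finprod_mono_neutral_cong_left)
    (use assms free_vs_mem[OF assms(2)] in \<open>auto simp: Pi_iff subset_eq\<close>)

lemma (in module) free_lift_hom:
  assumes h: "h \<in> S \<rightarrow> carrier M"
  shows "free_lift R M h \<in> module_hom R (free_vs R S) M"
proof (rule module_homI)
  fix f assume f: "f \<in> carrier (free_vs R S)"
  show "free_lift R M h f \<in> carrier M"
    unfolding free_lift_def
    using f h free_vs_mem[OF f] by (intro M.finsum_closed) (auto simp: carrier_free_vs)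
next
  fix f g assume f: "f \<in> carrier (free_vs R S)" and g: "g \<in> carrier (free_vs R S)"
  let ?A = "{s. f s \<noteq> \<zero>} \<union> {s. g s \<noteq> \<zero>}"
  have A: "finite ?A" "?A \<subseteq> S"
    using f g by (auto simp: carrier_free_vs)
  have hA: "h s \<in> carrier M" if "s \<in> ?A" for s using that A h by blast
  have "free_lift R M h (f \<oplus>\<^bsub>free_vs R S\<^esub> g) = (\<Oplus>\<^bsub>M\<^esub>s\<in>?A. (f s \<oplus> g s) \<odot>\<^bsub>M\<^esub> h s)"
    using free_vs_add_closed[OF f g] A
    by (subst free_lift_superset[OF h, of _ ?A]) (auto simp: free_vs_sel)
  also have "\<dots> = (\<Oplus>\<^bsub>M\<^esub>s\<in>?A. f s \<odot>\<^bsub>M\<^esub> h s \<oplus>\<^bsub>M\<^esub> g s \<odot>\<^bsub>M\<^esub> h s)"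
    using hA free_vs_mem[OF f] free_vs_mem[OF g]
    by (intro M.finsum_cong') (auto simp: smult_l_distr)
  also have "\<dots> = (\<Oplus>\<^bsub>M\<^esub>s\<in>?A. f s \<odot>\<^bsub>M\<^esub> h s) \<oplus>\<^bsub>M\<^esub> (\<Oplus>\<^bsub>M\<^esub>s\<in>?A. g s \<odot>\<^bsub>M\<^esub> h s)"
    using hA free_vs_mem[OF f] free_vs_mem[OF g] by (intro M.finsum_addf) auto
  also have "\<dots> = free_lift R M h f \<oplus>\<^bsub>M\<^esub> free_lift R M h g"
    using f g A by (simp add: free_lift_superset[OF h, of _ ?A])
  finally show "free_lift R M h (f \<oplus>\<^bsub>free_vs R S\<^esub> g) = free_lift R M h f \<oplus>\<^bsub>M\<^esub> free_lift R M h g" .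
next
  fix c f assume c: "c \<in> carrier R" and f: "f \<in> carrier (free_vs R S)"
  let ?A = "{s. f s \<noteq> \<zero>}"
  have A: "finite ?A" "?A \<subseteq> S"
    using f by (auto simp: carrier_free_vs)
  have hA: "h s \<in> carrier M" if "s \<in> ?A" for s using that A h by blast
  have "free_lift R M h (c \<odot>\<^bsub>free_vs R S\<^esub> f) = (\<Oplus>\<^bsub>M\<^esub>s\<in>?A. (c \<otimes> f s) \<odot>\<^bsub>M\<^esub> h s)"
    using free_vs_smult_closed[OF c f] A c
    by (subst free_lift_superset[OF h, of _ ?A]) (auto simp: free_vs_sel)
  also have "\<dots> = (\<Oplus>\<^bsub>M\<^esub>s\<in>?A. c \<odot>\<^bsub>M\<^esub> (f s \<odot>\<^bsub>M\<^esub> h s))"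
    using hA free_vs_mem[OF f] c by (intro M.finsum_cong') (auto simp: smult_assoc1)
  also have "\<dots> = c \<odot>\<^bsub>M\<^esub> free_lift R M h f"
    unfolding free_lift_def
    using A hA free_vs_mem[OF f] c by (subst finsum_smult_ldistr) auto
  finally show "free_lift R M h (c \<odot>\<^bsub>free_vs R S\<^esub> f) = c \<odot>\<^bsub>M\<^esub> free_lift R M h f" .
qed

lemma (in module) free_lift_gen:
  assumes "h \<in> S \<rightarrow> carrier M" "s \<in> S"
  shows "free_lift R M h (free_gen R s) = h s"
proof -
  have "h s \<in> carrier M" using assms by auto
  have "free_lift R M h (free_gen R s) = (\<Oplus>\<^bsub>M\<^esub>t\<in>{s}. free_gen R s t \<odot>\<^bsub>M\<^esub> h t)"
    by (rule free_lift_superset) (use assms free_gen_mem in \<open>auto simp: free_gen_def\<close>)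
  then show ?thesis
    using \<open>h s \<in> carrier M\<close> by (simp add: free_gen_def)
qed

section \<open>The universal property of the tensor product\<close>

text \<open>Phrased with \<open>module_hom\<close> in each variable, so that facts on linear maps
  apply directly to partial applications.\<close>

definition bilin ::
  "('k, 'r) ring_scheme \<Rightarrow> ('k, 'v, 'm) module_scheme \<Rightarrow> ('k, 'w, 'n) module_scheme \<Rightarrow>
     ('k, 'u, 'p) module_scheme \<Rightarrow> ('v \<Rightarrow> 'w \<Rightarrow> 'u) \<Rightarrow> bool" where
  "bilin K V W U f \<longleftrightarrow>
     (\<forall>x\<in>carrier V. f x \<in> module_hom K W U) \<and>
     (\<forall>y\<in>carrier W. (\<lambda>x. f x y) \<in> module_hom K V U)"

lemma bilin_mem: "\<lbrakk>bilin K V W U f; x \<in> carrier V; y \<in> carrier W\<rbrakk> \<Longrightarrow> f x y \<in> carrier U"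
  unfolding bilin_def by (blast intro: module_hom_mem)

lemma bilin_add1:
  "\<lbrakk>bilin K V W U f; x \<in> carrier V; x' \<in> carrier V; y \<in> carrier W\<rbrakk> \<Longrightarrow>
     f (x \<oplus>\<^bsub>V\<^esub> x') y = f x y \<oplus>\<^bsub>U\<^esub> f x' y"
  by (simp add: bilin_def module_hom_def)

lemma bilin_add2:
  "\<lbrakk>bilin K V W U f; x \<in> carrier V; y \<in> carrier W; y' \<in> carrier W\<rbrakk> \<Longrightarrow>
     f x (y \<oplus>\<^bsub>W\<^esub> y') = f x y \<oplus>\<^bsub>U\<^esub> f x y'"
  by (simp add: bilin_def module_hom_def)

lemma bilin_smult1:
  "\<lbrakk>bilin K V W U f; c \<in> carrier K; x \<in> carrier V; y \<in> carrier W\<rbrakk> \<Longrightarrow>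
     f (c \<odot>\<^bsub>V\<^esub> x) y = c \<odot>\<^bsub>U\<^esub> f x y"
  by (simp add: bilin_def module_hom_def)

lemma bilin_smult2:
  "\<lbrakk>bilin K V W U f; c \<in> carrier K; x \<in> carrier V; y \<in> carrier W\<rbrakk> \<Longrightarrow>
     f x (c \<odot>\<^bsub>W\<^esub> y) = c \<odot>\<^bsub>U\<^esub> f x y"
  by (simp add: bilin_def module_hom_def)

lemma tensor_rels_subset:
  assumes "module K V" "module K W"
  shows "tensor_rels K V W \<subseteq> carrier (free_vs K (carrier V \<times> carrier W))"
proof -
  interpret V: module K V by fact
  interpret W: module K W by fact
  interpret F: module K "free_vs K (carrier V \<times> carrier W)" by (rule V.module_free_vs)
  show ?thesis
    by (auto simp: tensor_rels_def Let_def V.free_gen_mem)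
qed

lemma tensor_null_submodule:
  assumes "module K V" "module K W"
  shows "submodule K (tensor_null K V W) (free_vs K (carrier V \<times> carrier W))"
proof -
  interpret V: module K V by fact
  interpret F: module K "free_vs K (carrier V \<times> carrier W)" by (rule V.module_free_vs)
  show ?thesis
    unfolding tensor_null_def by (intro F.span_is_submodule tensor_rels_subset assms)
qed

lemma module_tensor:
  assumes "module K V" "module K W"
  shows "module K (tensor K V W)"
  unfolding tensor_def by (intro module_quotient_vs tensor_null_submodule assms)

lemma tensor_proj_hom:
  assumes "module K V" "module K W"
  shows "(\<lambda>x. tensor_null K V W +>\<^bsub>free_vs K (carrier V \<times> carrier W)\<^esub> x)
    \<in> module_hom K (free_vs K (carrier V \<times> carrier W)) (tensor K V W)"
  unfolding tensor_def by (intro quotient_vs_proj_hom tensor_null_submodule assms)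

text \<open>Each relation is a difference of two elements of the free module, and its membership in
  the null space gives both the same coset. The four families of relations are the four laws of a
  bilinear map.\<close>

lemma bilin_tens:
  assumes "module K V" "module K W"
  shows "bilin K V W (tensor K V W) (tens K V W)"
proof -
  let ?F = "free_vs K (carrier V \<times> carrier W)"
  let ?N = "tensor_null K V W"
  let ?\<pi> = "\<lambda>x. ?N +>\<^bsub>?F\<^esub> x"
  interpret V: module K V by fact
  interpret W: module K W by fact
  interpret F: module K ?F by (rule V.module_free_vs)
  interpret T: module K "tensor K V W" by (rule module_tensor) fact+
  interpret P: mod_hom K ?F "tensor K V W" ?\<pi>
    by unfold_locales (rule tensor_proj_hom, fact+)
  interpret A: abelian_subgroup ?N ?F
    by (rule submodule_imp_abelian_subgroup[OF tensor_null_submodule]) fact+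
  have eq: "?\<pi> a = ?\<pi> b"
    if "a \<ominus>\<^bsub>?F\<^esub> b \<in> tensor_rels K V W" "a \<in> carrier ?F" "b \<in> carrier ?F" for a b
  proof -
    have "a \<ominus>\<^bsub>?F\<^esub> b \<in> ?N"
      using that(1) F.in_own_span[OF tensor_rels_subset[OF assms]] by (auto simp: tensor_null_def)
    then have "?\<pi> (a \<ominus>\<^bsub>?F\<^esub> b) = \<zero>\<^bsub>tensor K V W\<^esub>"
      by (simp add: A.a_rcos_const tensor_def quotient_vs_sel)
    then have "?\<pi> a \<ominus>\<^bsub>tensor K V W\<^esub> ?\<pi> b = \<zero>\<^bsub>tensor K V W\<^esub>"
      using that P.f_minus by simp
    then show ?thesis
      using that P.f_im T.minus_other_side by blast
  qed
  have gen: "free_gen K (x, y) \<in> carrier ?F" if "x \<in> carrier V" "y \<in> carrier W" for x y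
    using that by (intro V.free_gen_mem) auto
  have mem: "tens K V W x y \<in> carrier (tensor K V W)" if "x \<in> carrier V" "y \<in> carrier W" for x y
    unfolding tens_def using gen[OF that] P.f_im by blast
  have "tens K V W (x \<oplus>\<^bsub>V\<^esub> x') y = tens K V W x y \<oplus>\<^bsub>tensor K V W\<^esub> tens K V W x' y"
    if "x \<in> carrier V" "x' \<in> carrier V" "y \<in> carrier W" for x x' y
  proof -
    have "?\<pi> (free_gen K (x \<oplus>\<^bsub>V\<^esub> x', y)) = ?\<pi> (free_gen K (x, y) \<oplus>\<^bsub>?F\<^esub> free_gen K (x', y))"
      by (rule eq) (use that gen in \<open>auto simp: tensor_rels_def Let_def\<close>)
    then show ?thesis
      using that gen by (simp add: tens_def)
  qed
  moreover have "tens K V W x (y \<oplus>\<^bsub>W\<^esub> y') = tens K V W x y \<oplus>\<^bsub>tensor K V W\<^esub> tens K V W x y'"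
    if "x \<in> carrier V" "y \<in> carrier W" "y' \<in> carrier W" for x y y'
  proof -
    have "?\<pi> (free_gen K (x, y \<oplus>\<^bsub>W\<^esub> y')) = ?\<pi> (free_gen K (x, y) \<oplus>\<^bsub>?F\<^esub> free_gen K (x, y'))"
      by (rule eq) (use that gen in \<open>auto simp: tensor_rels_def Let_def\<close>)
    then show ?thesis
      using that gen by (simp add: tens_def)
  qed
  moreover have "tens K V W (c \<odot>\<^bsub>V\<^esub> x) y = c \<odot>\<^bsub>tensor K V W\<^esub> tens K V W x y"
    if "c \<in> carrier K" "x \<in> carrier V" "y \<in> carrier W" for c x y
  proof -
    have "?\<pi> (free_gen K (c \<odot>\<^bsub>V\<^esub> x, y)) = ?\<pi> (c \<odot>\<^bsub>?F\<^esub> free_gen K (x, y))"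
      by (rule eq) (use that gen in \<open>auto simp: tensor_rels_def Let_def\<close>)
    then show ?thesis
      using that gen by (simp add: tens_def)
  qed
  moreover have "tens K V W x (c \<odot>\<^bsub>W\<^esub> y) = c \<odot>\<^bsub>tensor K V W\<^esub> tens K V W x y"
    if "c \<in> carrier K" "x \<in> carrier V" "y \<in> carrier W" for c x y
  proof -
    have "?\<pi> (free_gen K (x, c \<odot>\<^bsub>W\<^esub> y)) = ?\<pi> (c \<odot>\<^bsub>?F\<^esub> free_gen K (x, y))"
      by (rule eq) (use that gen in \<open>auto simp: tensor_rels_def Let_def\<close>)
    then show ?thesis
      using that gen by (simp add: tens_def)
  qed
  ultimately show ?thesis
    using mem by (auto simp: bilin_def intro!: module_homI)
qed

text \<open>No scalar appears in the step, since c (x \<otimes> y) = (c x) \<otimes> y: pure tensors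
  generate the tensor product already under addition. The induction itself takes place in the free
  module.\<close>

lemma tensor_induct [consumes 3, case_names zero add]:
  assumes "module K V" "module K W" and t: "t \<in> carrier (tensor K V W)"
    and zero: "P \<zero>\<^bsub>tensor K V W\<^esub>"
    and add: "\<And>t x y. \<lbrakk>t \<in> carrier (tensor K V W); P t; x \<in> carrier V; y \<in> carrier W\<rbrakk> \<Longrightarrow>
      P (t \<oplus>\<^bsub>tensor K V W\<^esub> tens K V W x y)"
  shows "P t"
proof -
  let ?F = "free_vs K (carrier V \<times> carrier W)"
  let ?\<pi> = "\<lambda>x. tensor_null K V W +>\<^bsub>?F\<^esub> x"
  interpret V: module K V by fact
  interpret T: module K "tensor K V W" by (rule module_tensor) fact+
  interpret F: module K ?F by (rule V.module_free_vs)
  interpret Q: mod_hom K ?F "tensor K V W" ?\<pi>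
    by unfold_locales (rule tensor_proj_hom, fact+)
  note tens = bilin_tens[OF assms(1,2)]
  obtain f where f: "f \<in> carrier ?F" "t = ?\<pi> f"
    using t by (auto simp: tensor_def quotient_vs_sel)
  from f(1) have "P (?\<pi> f)"
  proof (induction f rule: V.free_vs_induct)
    case zero
    then show ?case using assms(4) Q.f0_is_0 by simp
  next
    case (add f c s)
    obtain x y where s: "s = (x, y)" "x \<in> carrier V" "y \<in> carrier W"
      using add by auto
    have "?\<pi> (f \<oplus>\<^bsub>?F\<^esub> (c \<odot>\<^bsub>?F\<^esub> free_gen K s)) = ?\<pi> f \<oplus>\<^bsub>tensor K V W\<^esub> (c \<odot>\<^bsub>tensor K V W\<^esub> ?\<pi> (free_gen K s))"
      using add V.free_gen_mem[of s "carrier V \<times> carrier W"] by simp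
    also have "\<dots> = ?\<pi> f \<oplus>\<^bsub>tensor K V W\<^esub> tens K V W (c \<odot>\<^bsub>V\<^esub> x) y"
      using s add bilin_smult1[OF tens] by (simp add: tens_def)
    finally show ?case
      using assms(5)[of "?\<pi> f" "c \<odot>\<^bsub>V\<^esub> x" y] add s Q.f_im by simp
  qed
  with f show ?thesis by simp
qed

text \<open>Uniqueness half of the universal property.\<close>

lemma tensor_hom_eqI:
  assumes "module K V" "module K W" "module K U"
    and F: "F \<in> module_hom K (tensor K V W) U" and G: "G \<in> module_hom K (tensor K V W) U"
    and eq: "\<And>x y. \<lbrakk>x \<in> carrier V; y \<in> carrier W\<rbrakk> \<Longrightarrow> F (tens K V W x y) = G (tens K V W x y)"
    and t: "t \<in> carrier (tensor K V W)"
  shows "F t = G t"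
  using assms(1,2) t
proof (induction t rule: tensor_induct)
  case zero
  show ?case
    using module_hom_zero[OF module_tensor[OF assms(1,2)] assms(3) F]
      module_hom_zero[OF module_tensor[OF assms(1,2)] assms(3) G] by simp
next
  case (add t x y)
  have "tens K V W x y \<in> carrier (tensor K V W)"
    using add bilin_mem[OF bilin_tens[OF assms(1,2)]] by blast
  with add eq show ?case
    by (simp add: module_hom_add[OF F] module_hom_add[OF G])
qed

text \<open>Existence half of the universal property: the linear extension of \<open>f\<close> to
  the free module vanishes on the relations and so factors through the quotient.\<close>

lemma tensor_lift_exists:
  assumes "module K V" "module K W" "module K U" and f: "bilin K V W U f"
  shows "\<exists>F. F \<in> module_hom K (tensor K V W) U \<and> F \<in> extensional (carrier (tensor K V W)) \<and>
    (\<forall>x\<in>carrier V. \<forall>y\<in>carrier W. F (tens K V W x y) = f x y)"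
proof -
  let ?F = "free_vs K (carrier V \<times> carrier W)"
  let ?N = "tensor_null K V W"
  let ?\<pi> = "\<lambda>x. ?N +>\<^bsub>?F\<^esub> x"
  interpret V: module K V by fact
  interpret W: module K W by fact
  interpret U: module K U by fact
  interpret F: module K ?F by (rule V.module_free_vs)
  interpret T: module K "tensor K V W" by (rule module_tensor) fact+
  interpret P: mod_hom K ?F "tensor K V W" ?\<pi>
    by unfold_locales (rule tensor_proj_hom, fact+)
  interpret A: abelian_subgroup ?N ?F
    by (rule submodule_imp_abelian_subgroup[OF tensor_null_submodule]) fact+
  have f_mem: "(\<lambda>(x, y). f x y) \<in> carrier V \<times> carrier W \<rightarrow> carrier U"
    using bilin_mem[OF f] by auto
  define g where "g = free_lift K U (\<lambda>(x, y). f x y)"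
  interpret g: mod_hom K ?F U g
    unfolding g_def by unfold_locales (rule U.free_lift_hom[OF f_mem])
  have g_gen: "g (free_gen K (x, y)) = f x y" if "x \<in> carrier V" "y \<in> carrier W" for x y
    using U.free_lift_gen[OF f_mem, of "(x, y)"] that by (simp add: g_def)
  have gen: "free_gen K (x, y) \<in> carrier ?F" if "x \<in> carrier V" "y \<in> carrier W" for x y
    using that by (intro V.free_gen_mem) auto
  \<comment> \<open>Bilinearity of \<open>f\<close> puts the generators of the null space into the
    kernel; being a submodule, the kernel then contains their span.\<close>
  have "tensor_rels K V W \<subseteq> g.ker"
    unfolding g.ker_def tensor_rels_def Let_def
    by (auto simp: gen g_gen bilin_mem[OF f] bilin_add1[OF f] bilin_add2[OF f]
        bilin_smult1[OF f] bilin_smult2[OF f])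
  then have ker: "?N \<subseteq> g.ker"
    unfolding tensor_null_def using F.span_is_subset g.ker_is_submodule by blast
  have well: "g a = g b" if "a \<in> ?\<pi> b" "b \<in> carrier ?F" for a b
  proof -
    have a: "a \<in> carrier ?F" using that A.a_elemrcos_carrier by blast
    have "a \<oplus>\<^bsub>?F\<^esub> \<ominus>\<^bsub>?F\<^esub> b \<in> g.ker" using that A.a_rcos_module_imp ker by blast
    then have "g a \<ominus>\<^bsub>U\<^esub> g b = \<zero>\<^bsub>U\<^esub>"
      using a that(2) g.f_ker g.f_minus by (metis a_minus_def)
    then show ?thesis
      using a that(2) by simp
  qed
  \<comment> \<open>A coset is evaluated at an arbitrarily chosen representative, which
    \<open>well\<close> makes harmless; \<open>restrict\<close> supplies the extensionality that
    \<open>tensor_lift\<close> demands.\<close>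
  define G where "G = restrict (\<lambda>A. g (SOME a. a \<in> A)) (carrier (tensor K V W))"
  have G: "G (?\<pi> a) = g a" if "a \<in> carrier ?F" for a
  proof -
    have "(SOME b. b \<in> ?\<pi> a) \<in> ?\<pi> a"
      using A.a_rcos_self[OF that] unfolding some_in_eq by blast
    then show ?thesis
      using that well P.f_im[OF that] by (simp add: G_def)
  qed
  have surj: "\<exists>a\<in>carrier ?F. t = ?\<pi> a" if "t \<in> carrier (tensor K V W)" for t
    using that by (auto simp: tensor_def quotient_vs_sel)
  have "G \<in> module_hom K (tensor K V W) U"
  proof (rule module_homI)
    fix t assume "t \<in> carrier (tensor K V W)"
    then obtain b where "b \<in> carrier ?F" "t = ?\<pi> b"
      using surj by blast
    then show "G t \<in> carrier U" by (simp only: G g.f_im)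
  next
    fix s t assume "s \<in> carrier (tensor K V W)" "t \<in> carrier (tensor K V W)"
    then obtain a b where ab: "a \<in> carrier ?F" "s = ?\<pi> a" "b \<in> carrier ?F" "t = ?\<pi> b"
      using surj by blast
    then have "G (?\<pi> (a \<oplus>\<^bsub>?F\<^esub> b)) = G s \<oplus>\<^bsub>U\<^esub> G t"
      by (simp only: G F.M.add.m_closed g.f_add)
    then show "G (s \<oplus>\<^bsub>tensor K V W\<^esub> t) = G s \<oplus>\<^bsub>U\<^esub> G t"
      using ab by (simp only: P.f_add)
  next
    fix c t assume c: "c \<in> carrier K" and "t \<in> carrier (tensor K V W)"
    then obtain b where ab: "b \<in> carrier ?F" "t = ?\<pi> b"
      using surj by blast
    then have "G (?\<pi> (c \<odot>\<^bsub>?F\<^esub> b)) = c \<odot>\<^bsub>U\<^esub> G t"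
      using c by (simp only: G F.smult_closed g.f_smult)
    then show "G (c \<odot>\<^bsub>tensor K V W\<^esub> t) = c \<odot>\<^bsub>U\<^esub> G t"
      using ab c by (simp only: P.f_smult)
  qed
  moreover have "G (tens K V W x y) = f x y" if "x \<in> carrier V" "y \<in> carrier W" for x y
    unfolding tens_def using that by (simp only: G gen g_gen)
  moreover have "G \<in> extensional (carrier (tensor K V W))"
    by (simp add: G_def)
  ultimately show ?thesis by blast
qed

text \<open>Two candidates agree on the carrier because they agree on pure tensors, and outside it
  by extensionality. The description thus has exactly one solution, and its defining property may be
  used.\<close>

lemma
  assumes "module K V" "module K W" "module K U" "bilin K V W U f"
  shows tensor_lift_hom: "tensor_lift K V W U f \<in> module_hom K (tensor K V W) U"
    and tensor_lift_tens:
      "\<lbrakk>x \<in> carrier V; y \<in> carrier W\<rbrakk> \<Longrightarrow> tensor_lift K V W U f (tens K V W x y) = f x y"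
proof -
  let ?P = "\<lambda>F. F \<in> module_hom K (tensor K V W) U \<and> F \<in> extensional (carrier (tensor K V W)) \<and>
    (\<forall>x\<in>carrier V. \<forall>y\<in>carrier W. F (tens K V W x y) = f x y)"
  have "\<exists>!F. ?P F"
  proof (rule ex_ex1I[OF tensor_lift_exists[OF assms]])
    fix F G assume FG: "?P F" "?P G"
    show "F = G"
    proof (rule extensionalityI)
      fix t assume "t \<in> carrier (tensor K V W)"
      with FG show "F t = G t"
        by (intro tensor_hom_eqI[OF assms(1-3), of F G t]) simp_all
    qed (use FG in blast)+
  qed
  from theI'[OF this] have *: "?P (tensor_lift K V W U f)"
    unfolding tensor_lift_def .
  then show "tensor_lift K V W U f \<in> module_hom K (tensor K V W) U"
    by (rule conjunct1)
  show "tensor_lift K V W U f (tens K V W x y) = f x y" if "x \<in> carrier V" "y \<in> carrier W"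
    using *[THEN conjunct2, THEN conjunct2] that by blast
qed

section \<open>Dependence of lifts on parameters, functoriality, associator and interchange\<close>

lemma tensor_lift_cong:
  assumes "\<And>x y. \<lbrakk>x \<in> carrier V; y \<in> carrier W\<rbrakk> \<Longrightarrow> f x y = g x y"
  shows "tensor_lift K V W U f = tensor_lift K V W U g"
  unfolding tensor_lift_def using assms by (intro arg_cong[where f = The] ext) auto

text \<open>This allows a lift to stand inside another lift: the inner value must be linear in a
  variable of the outer one. A general tensor has no canonical expression, so the claim goes by
  induction over sums of pure tensors, where the lift is known.\<close>

lemma tensor_lift_param_hom:
  assumes V: "module K V" and W: "module K W" and U: "module K U" and P: "module K P"
    and f: "\<And>p. p \<in> carrier P \<Longrightarrow> bilin K V W U (f p)"
    and lin: "\<And>x y. \<lbrakk>x \<in> carrier V; y \<in> carrier W\<rbrakk> \<Longrightarrow> (\<lambda>p. f p x y) \<in> module_hom K P U"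
    and t: "t \<in> carrier (tensor K V W)"
  shows "(\<lambda>p. tensor_lift K V W U (f p) t) \<in> module_hom K P U"
proof -
  interpret U: module K U by fact
  interpret P: module K P by fact
  interpret T: module K "tensor K V W" by (intro module_tensor V W)
  note hom = tensor_lift_hom[OF V W U f]
  \<comment> \<open>Linearity is transported along equality on the carrier of \<open>P\<close>,
    because for other \<open>p\<close> the map \<open>f p\<close> need not be bilinear and its lift
    is unspecified.\<close>
  have cong: "G \<in> module_hom K P U" if "F \<in> module_hom K P U" "\<And>p. p \<in> carrier P \<Longrightarrow> F p = G p" for F G
    using that(1) by (intro module_homI)
      (simp_all add: that(2)[symmetric] module_hom_mem module_hom_add module_hom_smult)
  show ?thesis
    using V W t
  proof (induction t rule: tensor_induct)
    case zero
    have "(\<lambda>_. \<zero>\<^bsub>U\<^esub>) \<in> module_hom K P U" by (rule module_homI) auto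
    then show ?case
      by (rule cong) (use module_hom_zero[OF T.module_axioms U hom] in simp)
  next
    case (add t x y)
    show ?case
    proof (rule cong[OF U.module_hom_sum[OF add.IH lin[OF add.hyps(2,3)]]])
      fix p assume "p \<in> carrier P"
      then show "tensor_lift K V W U (f p) t \<oplus>\<^bsub>U\<^esub> f p x y =
          tensor_lift K V W U (f p) (t \<oplus>\<^bsub>tensor K V W\<^esub> tens K V W x y)"
        using add.hyps bilin_mem[OF bilin_tens[OF V W]]
        by (simp add: module_hom_add[OF hom] tensor_lift_tens[OF V W U f])
    qed
  qed
qed

text \<open>The construction reads just these fields of its arguments. Tensor products of coalgebra
  records are hence the very same objects as those of the underlying modules, and are exchanged by
  rewriting instead of along an isomorphism.\<close>

lemma tensor_cong:
  assumes "carrier V' = carrier V" "add V' = add V" "smult V' = smult V"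
    and "carrier W' = carrier W" "add W' = add W" "smult W' = smult W"
  shows "tensor K V' W' = tensor K V W" "tens K V' W' = tens K V W"
proof -
  have "tensor_null K V' W' = tensor_null K V W"
    by (simp add: tensor_null_def tensor_rels_def assms)
  then show "tensor K V' W' = tensor K V W" "tens K V' W' = tens K V W"
    by (simp_all add: tensor_def tens_def assms fun_eq_iff)
qed

lemma tens_mem:
  "\<lbrakk>module K V; module K W; x \<in> carrier V; y \<in> carrier W\<rbrakk> \<Longrightarrow> tens K V W x y \<in> carrier (tensor K V W)"
  by (rule bilin_mem[OF bilin_tens])

lemma bilin_comp:
  assumes "bilin K V' W' U h" "f \<in> module_hom K V V'" "g \<in> module_hom K W W'"
  shows "bilin K V W U (\<lambda>x y. h (f x) (g y))"
  unfolding bilin_def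
proof (intro conjI ballI)
  fix x assume "x \<in> carrier V"
  then have "h (f x) \<in> module_hom K W' U"
    using assms by (simp add: bilin_def module_hom_mem)
  with assms(3) show "(\<lambda>y. h (f x) (g y)) \<in> module_hom K W U"
    by (rule module_hom_compose)
next
  fix y assume "y \<in> carrier W"
  then have "(\<lambda>x. h x (g y)) \<in> module_hom K V' U"
    using assms by (simp add: bilin_def module_hom_mem)
  with assms(2) show "(\<lambda>x. h (f x) (g y)) \<in> module_hom K V U"
    by (rule module_hom_compose)
qed

lemma bilin_swap: "bilin K W V U (\<lambda>y x. f x y)" if "bilin K V W U f"
  using that by (auto simp: bilin_def)

lemma bilin_hom1:
  "\<lbrakk>bilin K V W U h; f \<in> module_hom K P V; y \<in> carrier W\<rbrakk> \<Longrightarrow> (\<lambda>x. h (f x) y) \<in> module_hom K P U"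
  using module_hom_compose[of f K P V "\<lambda>x. h x y" U] by (simp add: bilin_def)

lemma bilin_hom2:
  "\<lbrakk>bilin K V W U h; f \<in> module_hom K P W; x \<in> carrier V\<rbrakk> \<Longrightarrow> (\<lambda>y. h x (f y)) \<in> module_hom K P U"
  using module_hom_compose[of f K P W "h x" U] by (simp add: bilin_def)

lemmas tens_hom1 = bilin_hom1[OF bilin_tens]
lemmas tens_hom2 = bilin_hom2[OF bilin_tens]

lemma bilin_tensor_lift:
  assumes "module K V" "module K W" "module K U" "module K P"
    and "\<And>p. p \<in> carrier P \<Longrightarrow> bilin K V W U (f p)"
    and "\<And>x y. \<lbrakk>x \<in> carrier V; y \<in> carrier W\<rbrakk> \<Longrightarrow> (\<lambda>p. f p x y) \<in> module_hom K P U"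
  shows "bilin K (tensor K V W) P U (\<lambda>t p. tensor_lift K V W U (f p) t)"
  unfolding bilin_def
  using tensor_lift_param_hom[OF assms] tensor_lift_hom[OF assms(1-3) assms(5)] by auto

lemma
  assumes "module K V" "module K W" "module K V'" "module K W'"
    and "f \<in> module_hom K V V'" "g \<in> module_hom K W W'"
  shows tensor_map_hom: "tensor_map K V W V' W' f g \<in> module_hom K (tensor K V W) (tensor K V' W')"
    and tensor_map_tens: "\<lbrakk>x \<in> carrier V; y \<in> carrier W\<rbrakk> \<Longrightarrow>
      tensor_map K V W V' W' f g (tens K V W x y) = tens K V' W' (f x) (g y)"
  unfolding tensor_map_def
  by (simp_all add: tensor_lift_hom tensor_lift_tens assms module_tensor
      bilin_comp[OF bilin_tens, OF assms(3-6)])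

lemma
  assumes [simp]: "module K U" "module K V" "module K W"
  shows tensor_assoc_hom:
      "tensor_assoc K U V W \<in>
        module_hom K (tensor K (tensor K U V) W) (tensor K U (tensor K V W))"
    and tensor_assoc_tens: "\<lbrakk>x \<in> carrier U; y \<in> carrier V; z \<in> carrier W\<rbrakk> \<Longrightarrow>
      tensor_assoc K U V W (tens K (tensor K U V) W (tens K U V x y) z) =
        tens K U (tensor K V W) x (tens K V W y z)"
proof -
  let ?A = "tensor K U (tensor K V W)"
  let ?q = "\<lambda>z x y. tens K U (tensor K V W) x (tens K V W y z)"
  have bil: "bilin K U V ?A (?q z)" if "z \<in> carrier W" for z
    by (rule bilin_comp[OF bilin_tens module_hom_id])
      (auto intro!: tens_hom1 module_hom_id module_tensor that)
  have *: "bilin K (tensor K U V) W ?A (\<lambda>s z. tensor_lift K U V ?A (?q z) s)"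
    by (rule bilin_tensor_lift)
      (auto intro!: bil tens_hom2 module_hom_id module_tensor)
  show "tensor_assoc K U V W \<in>
        module_hom K (tensor K (tensor K U V) W) (tensor K U (tensor K V W))"
    unfolding tensor_assoc_def Let_def by (rule tensor_lift_hom[OF _ _ _ *]) (auto intro!: module_tensor)
  show "tensor_assoc K U V W (tens K (tensor K U V) W (tens K U V x y) z) =
        tens K U (tensor K V W) x (tens K V W y z)"
    if "x \<in> carrier U" "y \<in> carrier V" "z \<in> carrier W"
    unfolding tensor_assoc_def Let_def
    using that by (simp add: tensor_lift_tens[OF _ _ _ *] tensor_lift_tens bil module_tensor tens_mem)
qed

lemma
  assumes [simp]: "module K U" "module K V" "module K U'" "module K V'"
  shows tensor_interchange_hom:
      "tensor_interchange K U V U' V' \<in>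
        module_hom K (tensor K (tensor K U V) (tensor K U' V'))
          (tensor K (tensor K U U') (tensor K V V'))"
    and tensor_interchange_tens:
      "\<lbrakk>u \<in> carrier U; v \<in> carrier V; u' \<in> carrier U'; v' \<in> carrier V'\<rbrakk> \<Longrightarrow>
        tensor_interchange K U V U' V'
          (tens K (tensor K U V) (tensor K U' V') (tens K U V u v) (tens K U' V' u' v')) =
        tens K (tensor K U U') (tensor K V V') (tens K U U' u u') (tens K V V' v v')"
proof -
  let ?A = "tensor K (tensor K U U') (tensor K V V')"
  let ?q = "\<lambda>u v u' v'. tens K (tensor K U U') (tensor K V V') (tens K U U' u u') (tens K V V' v v')"
  let ?l = "\<lambda>u v t. tensor_lift K U' V' ?A (?q u v) t"
  have bil: "bilin K U' V' ?A (?q u v)" if "u \<in> carrier U" "v \<in> carrier V" for u v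
    by (rule bilin_comp[OF bilin_tens])
      (auto intro!: tens_hom2 module_hom_id module_tensor that)
  \<comment> \<open>Here \<open>t\<close> is an arbitrary tensor, so linearity in \<open>u\<close>
    and in \<open>v\<close> cannot be read off from a formula; each is an instance of the linear
    dependence of a lift on a parameter.\<close>
  have bil': "bilin K U V ?A (\<lambda>u v. ?l u v t)" if "t \<in> carrier (tensor K U' V')" for t
    unfolding bilin_def
    by (intro conjI ballI tensor_lift_param_hom)
      (auto intro!: bil tens_hom2 tens_hom1 module_hom_id module_tensor tens_mem that)
  have *: "bilin K (tensor K U V) (tensor K U' V') ?A
      (\<lambda>s t. tensor_lift K U V ?A (\<lambda>u v. ?l u v t) s)"
    by (rule bilin_tensor_lift)
      (auto intro!: bil' tensor_lift_hom bil module_tensor)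
  show "tensor_interchange K U V U' V' \<in>
        module_hom K (tensor K (tensor K U V) (tensor K U' V'))
          (tensor K (tensor K U U') (tensor K V V'))"
    unfolding tensor_interchange_def Let_def
    by (rule tensor_lift_hom[OF _ _ _ *]) (auto intro!: module_tensor)
  show "tensor_interchange K U V U' V'
          (tens K (tensor K U V) (tensor K U' V') (tens K U V u v) (tens K U' V' u' v')) =
        tens K (tensor K U U') (tensor K V V') (tens K U U' u u') (tens K V V' v v')"
    if "u \<in> carrier U" "v \<in> carrier V" "u' \<in> carrier U'" "v' \<in> carrier V'"
    unfolding tensor_interchange_def Let_def
    using that
    by (simp add: tensor_lift_tens[OF _ _ _ *] tensor_lift_tens bil bil' module_tensor tens_mem)
qed

section \<open>Trilinear maps\<close>

definition trilin ::
  "('k, 'r) ring_scheme \<Rightarrow> ('k, 'v, 'm) module_scheme \<Rightarrow> ('k, 'u, 'p) module_scheme \<Rightarrow>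
     ('v \<Rightarrow> 'v \<Rightarrow> 'v \<Rightarrow> 'u) \<Rightarrow> bool" where
  "trilin K V U f \<longleftrightarrow> (\<forall>x\<in>carrier V. \<forall>y\<in>carrier V.
     (\<lambda>z. f z x y) \<in> module_hom K V U \<and> (\<lambda>z. f x z y) \<in> module_hom K V U \<and>
     f x y \<in> module_hom K V U)"

lemma trilin_bilin:
  "\<lbrakk>trilin K V U f; z \<in> carrier V\<rbrakk> \<Longrightarrow> bilin K V V U (\<lambda>x y. f x y z)"
  by (auto simp: trilin_def bilin_def)

lemma trilin_comp:
  assumes "trilin K V U f" "g1 \<in> module_hom K W V" "g2 \<in> module_hom K W V" "g3 \<in> module_hom K W V"
  shows "trilin K W U (\<lambda>x y z. f (g1 x) (g2 y) (g3 z))"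
  unfolding trilin_def
proof (intro ballI conjI)
  fix x y assume xy: "x \<in> carrier W" "y \<in> carrier W"
  show "(\<lambda>z. f (g1 z) (g2 x) (g3 y)) \<in> module_hom K W U"
    using module_hom_compose[OF assms(2), of "\<lambda>z. f z (g2 x) (g3 y)" U] assms xy
    by (simp add: trilin_def module_hom_mem)
  show "(\<lambda>z. f (g1 x) (g2 z) (g3 y)) \<in> module_hom K W U"
    using module_hom_compose[OF assms(3), of "\<lambda>z. f (g1 x) z (g3 y)" U] assms xy
    by (simp add: trilin_def module_hom_mem)
  show "(\<lambda>z. f (g1 x) (g2 y) (g3 z)) \<in> module_hom K W U"
    using module_hom_compose[OF assms(4), of "f (g1 x) (g2 y)" U] assms xy
    by (simp add: trilin_def module_hom_mem)
qed

lemma (in module) trilin_sum: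
  assumes "trilin R V M f" "trilin R V M g"
  shows "trilin R V M (\<lambda>x y z. f x y z \<oplus>\<^bsub>M\<^esub> g x y z)"
  using assms by (auto simp: trilin_def intro: module_hom_sum)

text \<open>The nested lift is literally the one in \<open>sweedler3\<close>, so these facts
  evaluate threefold Sweedler expressions; they also produce a linear operation from a trilinear
  formula.\<close>

lemma
  assumes [simp]: "module K V" "module K U" and f: "trilin K V U f"
  shows trilin_lift_hom: "tensor_lift K (tensor K V V) V U
      (\<lambda>s z. tensor_lift K V V U (\<lambda>x y. f x y z) s) \<in> module_hom K (tensor3 K V) U"
    and trilin_lift_tens3: "\<lbrakk>x \<in> carrier V; y \<in> carrier V; z \<in> carrier V\<rbrakk> \<Longrightarrow>
      tensor_lift K (tensor K V V) V U
        (\<lambda>s z. tensor_lift K V V U (\<lambda>x y. f x y z) s) (tens3 K V x y z) = f x y z"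
proof -
  have *: "bilin K (tensor K V V) V U (\<lambda>s z. tensor_lift K V V U (\<lambda>x y. f x y z) s)"
    by (rule bilin_tensor_lift) (use f in \<open>simp_all add: trilin_bilin[OF f] trilin_def\<close>)
  show "tensor_lift K (tensor K V V) V U
      (\<lambda>s z. tensor_lift K V V U (\<lambda>x y. f x y z) s) \<in> module_hom K (tensor3 K V) U"
    unfolding tensor3_def by (rule tensor_lift_hom[OF _ _ _ *]) (simp_all add: module_tensor)
  show "tensor_lift K (tensor K V V) V U
      (\<lambda>s z. tensor_lift K V V U (\<lambda>x y. f x y z) s) (tens3 K V x y z) = f x y z"
    if "x \<in> carrier V" "y \<in> carrier V" "z \<in> carrier V"
    using that
    by (simp add: tens3_def tensor_lift_tens[OF _ _ _ *] tensor_lift_tens[OF _ _ _ trilin_bilin[OF f]]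
        module_tensor tens_mem)
qed

lemma tensor3_hom_trilin:
  assumes [simp]: "module K V" and T: "T \<in> module_hom K (tensor3 K V) U"
  shows "trilin K V U (\<lambda>x y z. T (tens3 K V x y z))"
  unfolding trilin_def tens3_def
  using T unfolding tensor3_def
  by (intro ballI conjI module_hom_compose[OF _ T[unfolded tensor3_def]])
    (auto intro!: tens_hom1 tens_hom2 module_hom_id module_tensor tens_mem)

text \<open>Fixing the last factor reduces the claim to maps on the twofold tensor product.\<close>

lemma tensor3_hom_eqI:
  assumes [simp]: "module K V" "module K U"
    and F: "F \<in> module_hom K (tensor3 K V) U" and G: "G \<in> module_hom K (tensor3 K V) U"
    and eq: "\<And>x y z. \<lbrakk>x \<in> carrier V; y \<in> carrier V; z \<in> carrier V\<rbrakk> \<Longrightarrow>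
      F (tens3 K V x y z) = G (tens3 K V x y z)"
    and t: "t \<in> carrier (tensor3 K V)"
  shows "F t = G t"
proof (rule tensor_hom_eqI[of K "tensor K V V" V U])
  fix s z assume s: "s \<in> carrier (tensor K V V)" and z: "z \<in> carrier V"
  have hom: "(\<lambda>s. H (tens K (tensor K V V) V s z)) \<in> module_hom K (tensor K V V) U"
    if "H \<in> module_hom K (tensor3 K V) U" for H
    by (rule module_hom_compose[OF _ that[unfolded tensor3_def]])
      (auto intro!: tens_hom1 module_hom_id module_tensor z)
  show "F (tens K (tensor K V V) V s z) = G (tens K (tensor K V V) V s z)"
    by (rule tensor_hom_eqI[OF _ _ _ hom[OF F] hom[OF G] _ s])
      (use eq z in \<open>simp_all add: tens3_def\<close>)
qed (use F G t in \<open>simp_all add: tensor3_def module_tensor\<close>)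

section \<open>Tensor products of coalgebras\<close>

lemma tensor_coalgebra_sel:
  "carrier (tensor_coalgebra K C D) = carrier (tensor K C D)"
  "add (tensor_coalgebra K C D) = add (tensor K C D)"
  "zero (tensor_coalgebra K C D) = zero (tensor K C D)"
  "smult (tensor_coalgebra K C D) = smult (tensor K C D)"
  "comult (tensor_coalgebra K C D) = (\<lambda>t. tensor_interchange K C C D D
     (tensor_map K C D (tensor K C C) (tensor K D D) (comult C) (comult D) t))"
  "counit (tensor_coalgebra K C D) =
     tensor_lift K C D (self_module K) (\<lambda>c d. counit C c \<otimes>\<^bsub>K\<^esub> counit D d)"
  by (simp_all add: tensor_coalgebra_def module.defs coalgebra.defs)

lemma tensor_of_tensor_coalgebra:
  "tensor K (tensor_coalgebra K C D) W = tensor K (tensor K C D) W"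
  "tens K (tensor_coalgebra K C D) W = tens K (tensor K C D) W"
  "tensor K W (tensor_coalgebra K C D) = tensor K W (tensor K C D)"
  "tens K W (tensor_coalgebra K C D) = tens K W (tensor K C D)"
  by (rule tensor_cong; simp add: tensor_coalgebra_sel)+

lemma module_hom_tensor_coalgebra:
  "module_hom K (tensor_coalgebra K C D) U = module_hom K (tensor K C D) U"
  by (simp add: module_hom_def tensor_coalgebra_sel)

lemma module_tensor_coalgebra:
  assumes "module K C" "module K D"
  shows "module K (tensor_coalgebra K C D)"
  by (rule module_cong[OF module_tensor[OF assms]]) (simp_all add: tensor_coalgebra_sel)

lemma
  assumes [simp]: "module K C" "module K D"
    and "comult C \<in> module_hom K C (tensor K C C)" "comult D \<in> module_hom K D (tensor K D D)"
  shows tensor_coalgebra_comult_hom: "comult (tensor_coalgebra K C D) \<in>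
      module_hom K (tensor K C D) (tensor K (tensor K C D) (tensor K C D))"
    and tensor_coalgebra_comult_tens: "\<lbrakk>c \<in> carrier C; d \<in> carrier D\<rbrakk> \<Longrightarrow>
      comult (tensor_coalgebra K C D) (tens K C D c d) =
        tensor_interchange K C C D D (tens K (tensor K C C) (tensor K D D) (comult C c) (comult D d))"
  unfolding tensor_coalgebra_sel
  using assms(3,4)
  by (auto intro!: module_hom_compose[OF tensor_map_hom tensor_interchange_hom] module_tensor
      simp: tensor_map_tens module_tensor)

lemma module_self_module:
  assumes "cring K"
  shows "module K (self_module K)"
proof -
  interpret cring K by fact
  have "\<exists>y\<in>carrier (self_module K). x \<oplus>\<^bsub>self_module K\<^esub> y = \<zero>\<^bsub>self_module K\<^esub>"
    if "x \<in> carrier (self_module K)" for x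
    using that by (intro bexI[of _ "\<ominus>\<^bsub>K\<^esub> x"]) (auto simp: self_module_def r_neg)
  then show ?thesis
    using is_cring
    by (intro module_criteria) (auto simp: self_module_def a_ac m_assoc l_distr r_distr)
qed

lemma
  assumes [simp]: "module K C" "module K D"
    and C: "counit C \<in> module_hom K C (self_module K)" and D: "counit D \<in> module_hom K D (self_module K)"
  shows tensor_coalgebra_counit_hom:
      "counit (tensor_coalgebra K C D) \<in> module_hom K (tensor K C D) (self_module K)"
    and tensor_coalgebra_counit_tens: "\<lbrakk>c \<in> carrier C; d \<in> carrier D\<rbrakk> \<Longrightarrow>
      counit (tensor_coalgebra K C D) (tens K C D c d) = counit C c \<otimes>\<^bsub>K\<^esub> counit D d"
proof -
  interpret C: module K C by fact
  interpret S: module K "self_module K" by (rule module_self_module) (rule C.is_cring)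
  have "bilin K (self_module K) (self_module K) (self_module K) (mult K)"
    by (auto simp: bilin_def module_hom_def self_module_def C.l_distr C.r_distr C.m_ac)
  from bilin_comp[OF this C D]
  have *: "bilin K C D (self_module K) (\<lambda>c d. counit C c \<otimes>\<^bsub>K\<^esub> counit D d)" .
  show "counit (tensor_coalgebra K C D) \<in> module_hom K (tensor K C D) (self_module K)"
    "\<lbrakk>c \<in> carrier C; d \<in> carrier D\<rbrakk> \<Longrightarrow>
      counit (tensor_coalgebra K C D) (tens K C D c d) = counit C c \<otimes>\<^bsub>K\<^esub> counit D d"
    unfolding tensor_coalgebra_sel
    by (simp_all add: tensor_lift_hom tensor_lift_tens * S.module_axioms)
qed

text \<open>Source of bilinearity for the maps in the counit axioms. Linearity in the second
  variable rests on commutativity of the base ring.\<close>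

lemma (in module) bilin_smult: "bilin R (self_module R) M M (smult M)"
  unfolding bilin_def
proof (intro conjI ballI module_homI)
  fix c x r assume "c \<in> carrier (self_module R)" "r \<in> carrier R" "x \<in> carrier M"
  then show "c \<odot>\<^bsub>M\<^esub> (r \<odot>\<^bsub>M\<^esub> x) = r \<odot>\<^bsub>M\<^esub> (c \<odot>\<^bsub>M\<^esub> x)"
    by (simp add: self_module_def smult_assoc1[symmetric] R.m_comm)
qed (auto simp: self_module_def smult_l_distr smult_r_distr smult_assoc1)

section \<open>Coalgebras spanned by a grouplike element and primitive elements\<close>

text \<open>Abstracts k \<oplus> L to an element \<open>i\<close> and a projection \<open>p\<close>
  onto the kernel of the counit. That \<open>p\<close> kills \<open>i\<close>, lands in this kernel
  and is idempotent follows from \<open>decomp\<close>; with the formula for the coproduct this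
  makes \<open>i\<close> grouplike and every \<open>p c\<close> primitive.\<close>

locale primitive_coalgebra = vectorspace K X
  for K :: "('k, 'r) ring_scheme" and X :: "('k, 'v, 'm) coalgebra_scheme" +
  fixes i :: 'v and p :: "'v \<Rightarrow> 'v"
  assumes unit_mem: "i \<in> carrier X"
    and prim_hom: "p \<in> module_hom K X X"
    and counit_hom: "counit X \<in> module_hom K X (self_module K)"
    and counit_unit: "counit X i = \<one>\<^bsub>K\<^esub>"
    and decomp: "c \<in> carrier X \<Longrightarrow> counit X c \<odot>\<^bsub>X\<^esub> i \<oplus>\<^bsub>X\<^esub> p c = c"
    and comult: "c \<in> carrier X \<Longrightarrow>
      comult X c = tens K X X c i \<oplus>\<^bsub>tensor K X X\<^esub> tens K X X i (p c)"
begin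

abbreviation "XX \<equiv> tensor K X X"

lemma mod_X [simp]: "module K X" and mod_XX [simp]: "module K XX"
  and mod_XX_X [simp]: "module K (tensor K XX X)" and mod_X_XX [simp]: "module K (tensor K X XX)"
  and mod_XX_XX [simp]: "module K (tensor K XX XX)"
  and mod_XX_X2 [simp]: "module K (tensor K (tensor K XX X) (tensor K XX X))"
  by (simp_all add: module_tensor module_axioms)

lemma mod_self [simp]: "module K (self_module K)"
  by (rule module_self_module) (rule R.is_cring)

lemma unit_closed [simp]: "i \<in> carrier X"
  by (rule unit_mem)

lemma prim_closed [simp]: "c \<in> carrier X \<Longrightarrow> p c \<in> carrier X"
  by (rule module_hom_mem[OF prim_hom])

lemma counit_closed [simp]: "c \<in> carrier X \<Longrightarrow> counit X c \<in> carrier K"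
  using module_hom_mem[OF counit_hom] by (simp add: self_module_def)

lemma prim_unit [simp]: "p i = \<zero>\<^bsub>X\<^esub>"
  using decomp[of i] by (simp add: counit_unit M.add.r_cancel_one)

text \<open>Under the counit, the first summand of \<open>decomp\<close> already accounts for all of
  \<epsilon>(c).\<close>

lemma counit_prim [simp]: "c \<in> carrier X \<Longrightarrow> counit X (p c) = \<zero>\<^bsub>K\<^esub>"
  using arg_cong[OF decomp, of c "counit X"]
  by (simp add: module_hom_add[OF counit_hom] module_hom_smult[OF counit_hom])
    (simp add: self_module_def counit_unit)

lemma prim_prim [simp]: "c \<in> carrier X \<Longrightarrow> p (p c) = p c"
  using decomp[of "p c"] by simp

lemma tens_closed [simp]:
  "\<lbrakk>x \<in> carrier X; y \<in> carrier X\<rbrakk> \<Longrightarrow> tens K X X x y \<in> carrier XX"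
  "\<lbrakk>s \<in> carrier XX; z \<in> carrier X\<rbrakk> \<Longrightarrow> tens K XX X s z \<in> carrier (tensor K XX X)"
  "\<lbrakk>z \<in> carrier X; s \<in> carrier XX\<rbrakk> \<Longrightarrow> tens K X XX z s \<in> carrier (tensor K X XX)"
  "\<lbrakk>s \<in> carrier XX; t \<in> carrier XX\<rbrakk> \<Longrightarrow> tens K XX XX s t \<in> carrier (tensor K XX XX)"
  "\<lbrakk>u \<in> carrier (tensor K XX X); v \<in> carrier (tensor K XX X)\<rbrakk> \<Longrightarrow>
    tens K (tensor K XX X) (tensor K XX X) u v \<in> carrier (tensor K (tensor K XX X) (tensor K XX X))"
  by (simp_all add: tens_mem)

lemmas tens_add1 = bilin_add1[OF bilin_tens]
lemmas tens_add2 = bilin_add2[OF bilin_tens]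

lemma tens_zero:
  assumes "module K V" "module K W"
  shows "x \<in> carrier V \<Longrightarrow> tens K V W x \<zero>\<^bsub>W\<^esub> = \<zero>\<^bsub>tensor K V W\<^esub>"
    and "y \<in> carrier W \<Longrightarrow> tens K V W \<zero>\<^bsub>V\<^esub> y = \<zero>\<^bsub>tensor K V W\<^esub>"
  using module_hom_zero[OF assms(2) module_tensor[OF assms] tens_hom2[OF assms module_hom_id]]
    module_hom_zero[OF assms(1) module_tensor[OF assms] tens_hom1[OF assms module_hom_id]]
  by auto

sublocale XX: module K XX by simp
sublocale XX_X: module K "tensor K XX X" by simp
sublocale X_XX: module K "tensor K X XX" by simp
sublocale XX_XX: module K "tensor K XX XX" by simp
sublocale XX_X2: module K "tensor K (tensor K XX X) (tensor K XX X)" by simp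

lemma comult_unit: "comult X i = tens K X X i i"
  by (simp add: comult tens_zero)

lemma comult_hom: "comult X \<in> module_hom K X XX"
proof -
  have "(\<lambda>c. tens K X X c i \<oplus>\<^bsub>XX\<^esub> tens K X X i (p c)) \<in> module_hom K X XX"
    by (rule XX.module_hom_sum) (auto intro: tens_hom1 tens_hom2 module_hom_id prim_hom)
  then show ?thesis
    by (simp add: module_hom_def comult Pi_iff)
qed

lemma comult_mem [simp]: "c \<in> carrier X \<Longrightarrow> comult X c \<in> carrier XX"
  by (rule module_hom_mem[OF comult_hom])

text \<open>\<Delta> acts on the first factors of c \<otimes> i and i \<otimes> p c: the former
  contributes two terms, the latter one because \<open>i\<close> is grouplike.\<close>

lemma comult3:
  assumes "c \<in> carrier X"
  shows "comult3 K X c = tens3 K X c i i \<oplus>\<^bsub>tensor3 K X\<^esub> tens3 K X i (p c) i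
    \<oplus>\<^bsub>tensor3 K X\<^esub> tens3 K X i i (p c)"
proof -
  note hom = tensor_map_hom[OF _ _ _ _ comult_hom module_hom_id[of K X]]
  note tens = tensor_map_tens[OF _ _ _ _ comult_hom module_hom_id[of K X]]
  have "comult3 K X c = tens K XX X (comult X c) i \<oplus>\<^bsub>tensor K XX X\<^esub> tens K XX X (tens K X X i i) (p c)"
    using assms
    by (simp add: comult3_def comult[OF assms] module_hom_add[OF hom] tens)
       (simp add: comult[symmetric] comult_unit)
  then show ?thesis
    using assms by (simp add: comult tens_add1 tens3_def tensor3_def)
qed

lemma sweedler_eq:
  assumes [simp]: "module K U" and f: "bilin K X X U f" and c: "c \<in> carrier X"
  shows "sweedler K X U f c = f c i \<oplus>\<^bsub>U\<^esub> f i (p c)"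
  using c
  by (simp add: sweedler_def comult module_hom_add[OF tensor_lift_hom[OF _ _ _ f]]
      tensor_lift_tens[OF _ _ _ f])

lemma sweedler3_eq:
  assumes [simp]: "module K U" and f: "trilin K X U f" and c: "c \<in> carrier X"
  shows "sweedler3 K X U f c = f c i i \<oplus>\<^bsub>U\<^esub> f i (p c) i \<oplus>\<^bsub>U\<^esub> f i i (p c)"
proof -
  have mem: "tens3 K X x y z \<in> carrier (tensor3 K X)"
    if "x \<in> carrier X" "y \<in> carrier X" "z \<in> carrier X" for x y z
    using that by (simp add: tens3_def tensor3_def)
  interpret X3: module K "tensor3 K X" by (simp add: tensor3_def)
  show ?thesis
    using c
    by (simp add: sweedler3_def comult3 mem module_hom_add[OF trilin_lift_hom[OF _ _ f]]
        trilin_lift_tens3[OF _ _ f])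
qed

text \<open>Both sides of coassociativity are c \<otimes> i \<otimes> i + i \<otimes> p c \<otimes>
  i + i \<otimes> i \<otimes> p c, where the right-hand one uses p (p c) = p c. The left counit law
  is \<open>decomp\<close>; the right one comes from \<epsilon>(i) = 1 and \<epsilon>(p c) =
  0.\<close>

lemma coalgebra: "coalgebra K X"
proof
  fix c assume c: "c \<in> carrier X"
  note hom = tensor_map_hom[OF _ _ _ _ module_hom_id[of K X] comult_hom]
  note tens = tensor_map_tens[OF _ _ _ _ module_hom_id[of K X] comult_hom]
  have "tensor_map K X X X XX (\<lambda>x. x) (comult X) (comult X c) =
      tens K X XX c (tens K X X i i) \<oplus>\<^bsub>tensor K X XX\<^esub> tens K X XX i (comult X (p c))"
    using c by (simp add: comult[OF c] module_hom_add[OF hom] tens) (simp add: comult_unit)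
  then show "tensor_assoc K X X X (comult3 K X c) =
      tensor_map K X X X XX (\<lambda>x. x) (comult X) (comult X c)"
    using c by (simp add: comult comult3 tens3_def tensor3_def module_hom_add[OF tensor_assoc_hom]
        tensor_assoc_tens tens_add2 X_XX.M.a_assoc)
  have l: "bilin K X X X (\<lambda>x y. counit X x \<odot>\<^bsub>X\<^esub> y)"
    by (rule bilin_comp[OF bilin_smult counit_hom module_hom_id])
  show "tensor_lift K X X X (\<lambda>x y. counit X x \<odot>\<^bsub>X\<^esub> y) (comult X c) = c"
    using c sweedler_eq[OF _ l c] by (simp add: sweedler_def counit_unit decomp)
  show "tensor_lift K X X X (\<lambda>x y. counit X y \<odot>\<^bsub>X\<^esub> x) (comult X c) = c"
    using c sweedler_eq[OF _ bilin_swap[OF l] c] by (simp add: sweedler_def counit_unit)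
qed (rule comult_hom counit_hom)+

lemma comult_XX:
  assumes [simp]: "x \<in> carrier X" "y \<in> carrier X"
  shows "comult (tensor_coalgebra K X X) (tens K X X x y) =
    tens K XX XX (tens K X X x y) (tens K X X i i) \<oplus>\<^bsub>tensor K XX XX\<^esub>
    tens K XX XX (tens K X X i y) (tens K X X (p x) i) \<oplus>\<^bsub>tensor K XX XX\<^esub>
    (tens K XX XX (tens K X X x i) (tens K X X i (p y)) \<oplus>\<^bsub>tensor K XX XX\<^esub>
     tens K XX XX (tens K X X i i) (tens K X X (p x) (p y)))"
  by (simp add: tensor_coalgebra_comult_tens comult_hom comult tens_add1 tens_add2
      module_hom_add[OF tensor_interchange_hom] tensor_interchange_tens)

text \<open>The eight terms correspond to the subsets of {x, y, z}: an argument in the subset leaves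
  \<open>i\<close> in the first threefold tensor and puts its primitive part into the second, while
  any other stays in the first and puts \<open>i\<close> into the second.\<close>

lemma comult_XX_X:
  assumes [simp]: "x \<in> carrier X" "y \<in> carrier X" "z \<in> carrier X"
  defines "TT \<equiv> tensor K (tensor K XX X) (tensor K XX X)"
    and "tt \<equiv> \<lambda>a b c d e f. tens K (tensor K XX X) (tensor K XX X) (tens3 K X a b c) (tens3 K X d e f)"
  shows "comult (tensor_coalgebra K (tensor_coalgebra K X X) X) (tens3 K X x y z) =
    tt x y z i i i \<oplus>\<^bsub>TT\<^esub> tt i y z (p x) i i \<oplus>\<^bsub>TT\<^esub>
    (tt x i z i (p y) i \<oplus>\<^bsub>TT\<^esub> tt i i z (p x) (p y) i) \<oplus>\<^bsub>TT\<^esub>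
    (tt x y i i i (p z) \<oplus>\<^bsub>TT\<^esub> tt i y i (p x) i (p z) \<oplus>\<^bsub>TT\<^esub>
    (tt x i i i (p y) (p z) \<oplus>\<^bsub>TT\<^esub> tt i i i (p x) (p y) (p z)))"
proof -
  have [simp]: "module K (tensor_coalgebra K X X)" by (simp add: module_tensor_coalgebra)
  have hom: "comult (tensor_coalgebra K X X) \<in> module_hom K (tensor_coalgebra K X X)
      (tensor K (tensor_coalgebra K X X) (tensor_coalgebra K X X))"
    unfolding module_hom_tensor_coalgebra tensor_of_tensor_coalgebra
    by (rule tensor_coalgebra_comult_hom) (simp_all add: comult_hom)
  note tens = tensor_coalgebra_comult_tens[OF _ _ hom comult_hom]
  \<comment> \<open>Unfolding the outer coproduct produces interchanges over the record
    \<open>tensor_coalgebra K X X\<close>; \<open>cong\<close> turns them into interchanges over the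
    plain tensor square, matching the form of \<open>comult_XX\<close>.\<close>
  note inter_hom = tensor_interchange_hom[of K "tensor_coalgebra K X X" "tensor_coalgebra K X X" X X]
  note inter_tens = tensor_interchange_tens[of K "tensor_coalgebra K X X" "tensor_coalgebra K X X" X X]
  note cong = tensor_of_tensor_coalgebra module_hom_tensor_coalgebra tensor_coalgebra_sel(1)
  have [simp]: "tens3 K X a b c \<in> carrier (tensor K XX X)"
    if "a \<in> carrier X" "b \<in> carrier X" "c \<in> carrier X" for a b c
    using that by (simp add: tens3_def)
  interpret I: module K "tensor K (tensor K XX XX) XX" by (simp add: module_tensor)
  have [simp]: "tens K (tensor K XX XX) XX s t \<in> carrier (tensor K (tensor K XX XX) XX)"
    if "s \<in> carrier (tensor K XX XX)" "t \<in> carrier XX" for s t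
    using that by (simp add: tens_mem)
  show ?thesis
    unfolding TT_def tt_def
    by (simp add: tens3_def tens[unfolded cong] comult_XX comult[of z] tens_add1 tens_add2
      module_hom_add[OF inter_hom[unfolded cong]] inter_tens[unfolded cong])
qed

end

section \<open>Self-distributive operations on a primitive coalgebra\<close>

lemma sweedler_cong:
  assumes "\<And>x y. \<lbrakk>x \<in> carrier C; y \<in> carrier C\<rbrakk> \<Longrightarrow> f x y = g x y"
  shows "sweedler K C U f c = sweedler K C U g c"
  unfolding sweedler_def using assms by (simp cong: tensor_lift_cong)

text \<open>The summands agree on the carrier alone, so the equality has to pass under both lifts by
  congruence.\<close>

lemma sweedler3_cong:
  assumes "\<And>x y z. \<lbrakk>x \<in> carrier C; y \<in> carrier C; z \<in> carrier C\<rbrakk> \<Longrightarrow> f x y z = g x y z"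
  shows "sweedler3 K C U f c = sweedler3 K C U g c"
  unfolding sweedler3_def
proof (rule arg_cong[where f = "\<lambda>F. F (comult3 K C c)"], rule tensor_lift_cong)
  fix s z assume "z \<in> carrier C"
  then show "tensor_lift K C C U (\<lambda>x y. f x y z) s = tensor_lift K C C U (\<lambda>x y. g x y z) s"
    using assms by (simp cong: tensor_lift_cong)
qed

text \<open>The assumptions are equations between values on pure tensors. \<open>prim_op\<close>
  splits the primitive part of a value into the two terms that the coproduct condition produces. In
  \<open>op_derivation\<close> the first summand alone keeps \<open>u\<close> and \<open>v\<close>
  whole, because the threefold coproduct leaves its argument whole in the first slot and puts
  primitive parts into the other two.\<close>

locale primitive_tsd = primitive_coalgebra K X i p
  for K :: "('k, 'r) ring_scheme" and X :: "('k, 'v, 'm) coalgebra_scheme" and i p +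
  fixes T :: "(('v \<times> 'v \<Rightarrow> 'k) set \<times> 'v \<Rightarrow> 'k) set \<Rightarrow> 'v" and op3
  defines "op3 \<equiv> \<lambda>x y z. T (tens3 K X x y z)"
  assumes T_hom: "T \<in> module_hom K (tensor3 K X) X"
    and op_unit_unit: "x \<in> carrier X \<Longrightarrow> op3 x i i = x"
    and op_unit_prim: "\<lbrakk>x \<in> carrier X; z \<in> carrier X\<rbrakk> \<Longrightarrow> op3 x i (p z) = \<zero>\<^bsub>X\<^esub>"
    and op_prim_unit: "\<lbrakk>x \<in> carrier X; y \<in> carrier X\<rbrakk> \<Longrightarrow> op3 x (p y) i = \<zero>\<^bsub>X\<^esub>"
    and op_unit1: "\<lbrakk>y \<in> carrier X; z \<in> carrier X\<rbrakk> \<Longrightarrow>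
      op3 i y z = (counit X y \<otimes>\<^bsub>K\<^esub> counit X z) \<odot>\<^bsub>X\<^esub> i"
    and prim_op: "\<lbrakk>x \<in> carrier X; y \<in> carrier X; z \<in> carrier X\<rbrakk> \<Longrightarrow>
      p (op3 x y z) = (counit X y \<otimes>\<^bsub>K\<^esub> counit X z) \<odot>\<^bsub>X\<^esub> p x \<oplus>\<^bsub>X\<^esub> op3 (p x) (p y) (p z)"
    and counit_op: "\<lbrakk>x \<in> carrier X; y \<in> carrier X; z \<in> carrier X\<rbrakk> \<Longrightarrow>
      counit X (op3 x y z) = counit X x \<otimes>\<^bsub>K\<^esub> counit X y \<otimes>\<^bsub>K\<^esub> counit X z"
    and op_derivation:
      "\<lbrakk>x \<in> carrier X; y \<in> carrier X; z \<in> carrier X; u \<in> carrier X; v \<in> carrier X\<rbrakk> \<Longrightarrow>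
        op3 (op3 x y z) u v =
          op3 (op3 x u v) y z \<oplus>\<^bsub>X\<^esub> op3 x (op3 y (p u) (p v)) z \<oplus>\<^bsub>X\<^esub> op3 x y (op3 z (p u) (p v))"
    and op_skew: "\<lbrakk>x \<in> carrier X; y \<in> carrier X; z \<in> carrier X\<rbrakk> \<Longrightarrow>
      op3 x z y \<oplus>\<^bsub>X\<^esub> op3 x (p y) (p z) = (counit X y \<otimes>\<^bsub>K\<^esub> counit X z) \<odot>\<^bsub>X\<^esub> x"
begin

lemma op3_apply: "T (tens3 K X x y z) = op3 x y z"
  by (simp add: op3_def)

lemma trilin_op: "trilin K X X op3"
  unfolding op3_def by (rule tensor3_hom_trilin[OF _ T_hom]) simp

lemma op_hom:
  assumes "x \<in> carrier X" "y \<in> carrier X"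
  shows "(\<lambda>z. op3 z x y) \<in> module_hom K X X" "(\<lambda>z. op3 x z y) \<in> module_hom K X X"
    "op3 x y \<in> module_hom K X X"
  using trilin_op assms by (auto simp: trilin_def)

lemma op_closed [simp]:
  "\<lbrakk>x \<in> carrier X; y \<in> carrier X; z \<in> carrier X\<rbrakk> \<Longrightarrow> op3 x y z \<in> carrier X"
  using op_hom(3) by (rule module_hom_mem)

lemma op_zero [simp]:
  assumes "x \<in> carrier X" "y \<in> carrier X"
  shows "op3 \<zero>\<^bsub>X\<^esub> x y = \<zero>\<^bsub>X\<^esub>" "op3 x \<zero>\<^bsub>X\<^esub> y = \<zero>\<^bsub>X\<^esub>" "op3 x y \<zero>\<^bsub>X\<^esub> = \<zero>\<^bsub>X\<^esub>"
  using module_hom_zero[OF mod_X mod_X op_hom(1)[OF assms]]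
    module_hom_zero[OF mod_X mod_X op_hom(2)[OF assms]]
    module_hom_zero[OF mod_X mod_X op_hom(3)[OF assms]] by simp_all

text \<open>Both conditions compare linear maps on the threefold tensor power, so pure tensors
  suffice.\<close>

lemma coalgebra_hom: "T \<in> coalgebra_hom K (tensor_coalgebra K (tensor_coalgebra K X X) X) X"
proof -
  let ?XX = "tensor_coalgebra K X X"
  let ?X3 = "tensor_coalgebra K ?XX X"
  let ?TT = "tensor_map K (tensor3 K X) (tensor3 K X) X X T T"
  note cong = tensor_of_tensor_coalgebra module_hom_tensor_coalgebra tensor_coalgebra_sel(1-4)
  have mod3 [simp]: "module K (tensor3 K X)" by (simp add: tensor3_def)
  have [simp]: "module K ?XX" by (simp add: module_tensor_coalgebra)
  have comultXX: "comult ?XX \<in> module_hom K ?XX (tensor K ?XX ?XX)"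
    unfolding cong by (rule tensor_coalgebra_comult_hom) (simp_all add: comult_hom)
  have comultX3: "comult ?X3 \<in> module_hom K (tensor3 K X) (tensor K (tensor3 K X) (tensor3 K X))"
    using tensor_coalgebra_comult_hom[OF _ _ comultXX comult_hom]
    by (simp add: cong tensor3_def)
  have counitXX: "counit ?XX \<in> module_hom K ?XX (self_module K)"
    unfolding cong by (rule tensor_coalgebra_counit_hom) (simp_all add: counit_hom)
  have counitX3: "counit ?X3 \<in> module_hom K (tensor3 K X) (self_module K)"
    using tensor_coalgebra_counit_hom[OF _ _ counitXX counit_hom]
    by (simp add: cong tensor3_def)
  note TT_hom = tensor_map_hom[OF mod3 mod3 mod_X mod_X T_hom T_hom]
  have tens3: "tens3 K X x y z \<in> carrier (tensor3 K X)"
    if "x \<in> carrier X" "y \<in> carrier X" "z \<in> carrier X" for x y z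
    using that by (simp add: tens3_def tensor3_def)
  have TT_tens: "?TT (tens K (tensor3 K X) (tensor3 K X) (tens3 K X a b c) (tens3 K X d e f)) =
      tens K X X (op3 a b c) (op3 d e f)"
    if "a \<in> carrier X" "b \<in> carrier X" "c \<in> carrier X" "d \<in> carrier X" "e \<in> carrier X" "f \<in> carrier X"
    for a b c d e f
    using that by (simp add: tensor_map_tens[OF mod3 mod3 mod_X mod_X T_hom T_hom] tens3 op3_def)
  have tt: "tens K (tensor3 K X) (tensor3 K X) (tens3 K X a b c) (tens3 K X d e f)
      \<in> carrier (tensor K (tensor3 K X) (tensor3 K X))"
    if "a \<in> carrier X" "b \<in> carrier X" "c \<in> carrier X" "d \<in> carrier X" "e \<in> carrier X" "f \<in> carrier X"
    for a b c d e f
    using that by (simp add: tens_mem tens3)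
  interpret X33: module K "tensor K (tensor3 K X) (tensor3 K X)" by (simp add: module_tensor)
  have comult_T: "comult X (T s) = ?TT (comult ?X3 s)" if "s \<in> carrier (tensor3 K X)" for s
  proof (rule tensor3_hom_eqI[OF _ _ _ _ _ that])
    fix x y z assume xyz [simp]: "x \<in> carrier X" "y \<in> carrier X" "z \<in> carrier X"
    \<comment> \<open>Moving nothing, \<open>x\<close> alone, or all three arguments to the second
      factor gives the surviving terms; in the other five the operation vanishes on the second
      factor.\<close>
    have "?TT (comult ?X3 (tens3 K X x y z)) =
        tens K X X (op3 x y z) i \<oplus>\<^bsub>XX\<^esub> tens K X X ((counit X y \<otimes>\<^bsub>K\<^esub> counit X z) \<odot>\<^bsub>X\<^esub> i) (p x)
          \<oplus>\<^bsub>XX\<^esub> tens K X X i (op3 (p x) (p y) (p z))"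
      unfolding comult_XX_X[OF xyz, folded tensor3_def]
      by (simp add: module_hom_add[OF TT_hom] TT_tens tt tens_zero op_unit_unit op_unit_prim
          op_prim_unit op_unit1 counit_unit)
    \<comment> \<open>By \<open>prim_op\<close> the last two terms together are i \<otimes> p (op3 x
      y z), once the scalar has been moved across the tensor sign.\<close>
    also have "\<dots> = comult X (op3 x y z)"
      by (simp add: comult prim_op tens_add2 bilin_smult1[OF bilin_tens] bilin_smult2[OF bilin_tens]
          XX.M.a_assoc)
    finally show "comult X (T (tens3 K X x y z)) = ?TT (comult ?X3 (tens3 K X x y z))"
      by (simp add: op3_def)
  qed (auto intro: module_hom_compose T_hom comult_hom comultX3 TT_hom)
  have counit_T: "counit X (T s) = counit ?X3 s" if "s \<in> carrier (tensor3 K X)" for s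
  proof (rule tensor3_hom_eqI[OF _ _ _ _ _ that])
    fix x y z assume [simp]: "x \<in> carrier X" "y \<in> carrier X" "z \<in> carrier X"
    show "counit X (T (tens3 K X x y z)) = counit ?X3 (tens3 K X x y z)"
      using tensor_coalgebra_counit_tens[OF _ _ counitXX counit_hom, of "tens K X X x y" z]
      by (simp add: cong tens3_def tensor_coalgebra_counit_tens[OF _ _ counit_hom counit_hom]
          counit_op[unfolded op3_def tens3_def])
  qed (auto intro: module_hom_compose[OF T_hom counit_hom] counitX3)
  have X3: "tensor K ?X3 ?X3 = tensor K (tensor3 K X) (tensor3 K X)"
    "tens K ?X3 ?X3 = tens K (tensor3 K X) (tensor3 K X)" "carrier ?X3 = carrier (tensor3 K X)"
    by (simp_all add: cong tensor3_def)
  \<comment> \<open>The notion of coalgebra morphism refers to the coalgebra record. It enters the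
    definite description through its carrier and tensor products, so both descriptions
    coincide.\<close>
  then have "tensor_map K ?X3 ?X3 X X T T = ?TT"
    by (simp add: tensor_map_def tensor_lift_def)
  moreover have "T \<in> module_hom K ?X3 X"
    using T_hom by (simp add: cong tensor3_def)
  ultimately show ?thesis
    using comult_T counit_T by (simp add: coalgebra_hom_def X3)
qed

text \<open>Expanding both coproducts gives nine terms, indexed by the slots that receive the
  non-unit parts of \<open>u\<close> and \<open>v\<close>. If these slots differ, one of them is not
  the first, and the inner operation there has the form \<open>op3 _ (p u) i\<close> or
  \<open>op3 _ i (p v)\<close>, which is zero. The three terms with equal slots are the right side
  of \<open>op_derivation\<close>.\<close>

lemma self_distributive:
  assumes [simp]: "x \<in> carrier X" "y \<in> carrier X" "z \<in> carrier X"
    and u [simp]: "u \<in> carrier X" and v [simp]: "v \<in> carrier X"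
  shows "op3 (op3 x y z) u v = sweedler3 K X X (\<lambda>u1 u2 u3. sweedler3 K X X (\<lambda>v1 v2 v3.
    op3 (op3 x u1 v1) (op3 y u2 v2) (op3 z u3 v3)) v) u"
proof -
  let ?f = "\<lambda>u1 u2 u3 v1 v2 v3. op3 (op3 x u1 v1) (op3 y u2 v2) (op3 z u3 v3)"
  let ?g = "\<lambda>u1 u2 u3. ?f u1 u2 u3 v i i \<oplus>\<^bsub>X\<^esub> ?f u1 u2 u3 i (p v) i \<oplus>\<^bsub>X\<^esub> ?f u1 u2 u3 i i (p v)"
  have f: "trilin K X X (?f u1 u2 u3)"
    if "u1 \<in> carrier X" "u2 \<in> carrier X" "u3 \<in> carrier X" for u1 u2 u3
    using that by (intro trilin_comp[OF trilin_op] op_hom) auto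
  \<comment> \<open>The expansion in \<open>v\<close> must itself be trilinear in the outer
    variables before the Sweedler sum over \<open>u\<close> can be evaluated.\<close>
  have g: "trilin K X X ?g"
    by (intro trilin_sum trilin_comp[OF trilin_op] op_hom) auto
  have "sweedler3 K X X (\<lambda>u1 u2 u3. sweedler3 K X X (?f u1 u2 u3) v) u = sweedler3 K X X ?g u"
  proof (rule sweedler3_cong)
    fix u1 u2 u3 assume "u1 \<in> carrier X" "u2 \<in> carrier X" "u3 \<in> carrier X"
    then show "sweedler3 K X X (?f u1 u2 u3) v = ?g u1 u2 u3"
      by (intro sweedler3_eq f) auto
  qed
  also have "\<dots> = op3 (op3 x u v) y z \<oplus>\<^bsub>X\<^esub> op3 x (op3 y (p u) (p v)) z \<oplus>\<^bsub>X\<^esub> op3 x y (op3 z (p u) (p v))"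
    by (simp add: sweedler3_eq[OF _ g] op_unit_unit op_unit_prim op_prim_unit)
  finally show ?thesis by (simp only: op_derivation[OF assms])
qed

text \<open>Of the four terms the two mixed ones contain \<open>op3 x i (p z)\<close> or
  \<open>op3 x (p y) i\<close> and vanish; the rest is the left side of
  \<open>op_skew\<close>.\<close>

lemma left_inverse: "tsd_left_inverse K X T T"
  unfolding tsd_left_inverse_def op3_apply
proof (intro ballI)
  fix x y z assume xyz [simp]: "x \<in> carrier X" "y \<in> carrier X" "z \<in> carrier X"
  let ?f = "\<lambda>y1 y2 z1 z2. op3 (op3 x y2 z2) z1 y1"
  let ?g = "\<lambda>y1 y2. ?f y1 y2 z i \<oplus>\<^bsub>X\<^esub> ?f y1 y2 i (p z)"
  have f: "bilin K X X X (?f y1 y2)" if "y1 \<in> carrier X" "y2 \<in> carrier X" for y1 y2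
    unfolding bilin_def
    using that by (auto intro!: op_hom module_hom_compose[OF op_hom(3) op_hom(1)])
  have g: "bilin K X X X ?g"
    unfolding bilin_def
    by (auto intro!: module_hom_sum op_hom module_hom_compose[OF op_hom(2) op_hom(1)])
  have "sweedler K X X (\<lambda>y1 y2. sweedler K X X (?f y1 y2) z) y = sweedler K X X ?g y"
  proof (rule sweedler_cong)
    fix y1 y2 assume "y1 \<in> carrier X" "y2 \<in> carrier X"
    then show "sweedler K X X (?f y1 y2) z = ?g y1 y2"
      by (intro sweedler_eq f) auto
  qed
  also have "\<dots> = op3 x z y \<oplus>\<^bsub>X\<^esub> op3 x (p y) (p z)"
    by (simp add: sweedler_eq[OF _ g] op_unit_unit op_unit_prim op_prim_unit)
  also have "\<dots> = (counit X y \<otimes>\<^bsub>K\<^esub> counit X z) \<odot>\<^bsub>X\<^esub> x"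
    by (simp add: op_skew)
  finally show "sweedler K X X (\<lambda>y1 y2. sweedler K X X (?f y1 y2) z) y =
      (counit X y \<otimes>\<^bsub>K\<^esub> counit X z) \<odot>\<^bsub>X\<^esub> x" .
qed

lemma tsd_object: "tsd_object K X T"
  using coalgebra coalgebra_hom self_distributive[unfolded op3_def]
  by (intro tsd_object.intro tsd_object_axioms.intro) auto

lemma reversible: "reversible_tsd K X T"
  unfolding reversible_tsd_def using tsd_object T_hom left_inverse by blast

end

section \<open>The coalgebra of a 3-Lie algebra\<close>

context three_lie_algebra
begin

lemma br_swap:
  assumes "x \<in> carrier L" "y \<in> carrier L" "z \<in> carrier L"
  shows "br x z y = \<ominus>\<^bsub>L\<^esub> br x y z"
proof -
  \<comment> \<open>\<open>w\<close> lists the arguments of the left-hand side, so composing it with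
    the transposition of 2 and 3 restores the order \<open>x\<close>, \<open>y\<close>,
    \<open>z\<close>.\<close>
  define w where "w n = (if n = 1 then x else if n = 2 then z else y)" for n :: nat
  have sw: "sign (transpose 2 3 :: nat \<Rightarrow> nat) = -1" by (simp add: sign_swap_id)
  have mem: "br x y z \<in> carrier L" using module_hom_mem[OF linear3] assms by simp
  have "br (w 1) (w 2) (w 3) = [sign (transpose 2 3 :: nat \<Rightarrow> nat)] \<cdot>\<^bsub>L\<^esub>
      br (w (transpose 2 3 1)) (w (transpose 2 3 2)) (w (transpose 2 3 3))"
    by (rule skew) (use assms in \<open>auto simp: w_def intro: permutes_swap_id\<close>)
  then show ?thesis
    \<comment> \<open>The sign acts as an integer multiple in the additive group, and the multiple
      by -1 is the negative.\<close>
    using mem M.add.int_pow_neg[OF mem, of 1] by (simp add: sw w_def transpose_def M.add.int_pow_1)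
qed

lemma
  assumes "x \<in> carrier L" "y \<in> carrier L"
  shows br_zero1: "br \<zero>\<^bsub>L\<^esub> x y = \<zero>\<^bsub>L\<^esub>"
    and br_zero2: "br x \<zero>\<^bsub>L\<^esub> y = \<zero>\<^bsub>L\<^esub>"
    and br_zero3: "br x y \<zero>\<^bsub>L\<^esub> = \<zero>\<^bsub>L\<^esub>"
  using module_hom_zero[OF module_axioms module_axioms linear1[OF assms]]
    module_hom_zero[OF module_axioms module_axioms linear2[OF assms]]
    module_hom_zero[OF module_axioms module_axioms linear3[OF assms]] by simp_all

lemma br_closed:
  "\<lbrakk>x \<in> carrier L; y \<in> carrier L; z \<in> carrier L\<rbrakk> \<Longrightarrow> br x y z \<in> carrier L"
  by (rule module_hom_mem[OF linear3])

abbreviation "X \<equiv> three_lie_coalgebra K L"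

lemma three_lie_coalgebra_sel:
  "carrier X = carrier K \<times> carrier L"
  "zero X = (\<zero>\<^bsub>K\<^esub>, \<zero>\<^bsub>L\<^esub>)"
  "add X v w = (fst v \<oplus>\<^bsub>K\<^esub> fst w, snd v \<oplus>\<^bsub>L\<^esub> snd w)"
  "smult X c v = (c \<otimes>\<^bsub>K\<^esub> fst v, c \<odot>\<^bsub>L\<^esub> snd v)"
  "counit X v = fst v"
  by (auto simp: three_lie_coalgebra_def Let_def module.defs coalgebra.defs direct_sum_def
      self_module_def split: prod.split)

lemma three_lie_coalgebra_direct_sum:
  "carrier X = carrier (direct_sum (self_module K) L)"
  "add X = add (direct_sum (self_module K) L)"
  "zero X = zero (direct_sum (self_module K) L)"
  "smult X = smult (direct_sum (self_module K) L)"
  by (simp_all add: three_lie_coalgebra_def Let_def module.defs)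

text \<open>The coproduct was defined in the tensor square of the bare direct sum; that of the
  coalgebra record is the same object, so the formula carries over.\<close>

lemma three_lie_comult:
  "comult X v = tens K X X v (\<one>\<^bsub>K\<^esub>, \<zero>\<^bsub>L\<^esub>) \<oplus>\<^bsub>tensor K X X\<^esub> tens K X X (\<one>\<^bsub>K\<^esub>, \<zero>\<^bsub>L\<^esub>) (\<zero>\<^bsub>K\<^esub>, snd v)"
  unfolding tensor_cong[OF three_lie_coalgebra_direct_sum(1,2,4) three_lie_coalgebra_direct_sum(1,2,4)]
  by (cases v) (simp add: three_lie_coalgebra_def Let_def module.defs coalgebra.defs)

lemma module_three_lie_coalgebra: "module K X"
  by (rule module_cong[OF direct_sum_is_module[OF module_self_module[OF R.is_cring] module_axioms]
        three_lie_coalgebra_direct_sum])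

definition three_lie_tri :: "'k \<times> 'l \<Rightarrow> 'k \<times> 'l \<Rightarrow> 'k \<times> 'l \<Rightarrow> 'k \<times> 'l" where
  "three_lie_tri u v w = (fst u \<otimes>\<^bsub>K\<^esub> fst v \<otimes>\<^bsub>K\<^esub> fst w,
     (fst v \<otimes>\<^bsub>K\<^esub> fst w) \<odot>\<^bsub>L\<^esub> snd u \<oplus>\<^bsub>L\<^esub> br (snd u) (snd v) (snd w))"

lemma trilin_three_lie: "trilin K X X three_lie_tri"
  unfolding trilin_def three_lie_tri_def
proof (intro ballI conjI module_homI; clarsimp simp: three_lie_coalgebra_sel)
qed (simp_all add: br_closed module_hom_add[OF linear1] module_hom_add[OF linear2] module_hom_add[OF linear3]
  module_hom_smult[OF linear1] module_hom_smult[OF linear2] module_hom_smult[OF linear3]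
  smult_l_distr smult_r_distr R.l_distr R.r_distr M.a_ac R.m_ac smult_assoc1[symmetric])

text \<open>The formula is trilinear, so it extends to a linear map; claims about every such
  \<open>T\<close> are thereby not vacuous.\<close>

lemma three_lie_op_exists: "\<exists>T. is_three_lie_op K L br T"
proof (intro exI)
  show "is_three_lie_op K L br (tensor_lift K (tensor K X X) X X
      (\<lambda>s z. tensor_lift K X X X (\<lambda>x y. three_lie_tri x y z) s))"
    unfolding is_three_lie_op_def Let_def
    using trilin_lift_hom[OF module_three_lie_coalgebra module_three_lie_coalgebra trilin_three_lie]
      trilin_lift_tens3[OF module_three_lie_coalgebra module_three_lie_coalgebra trilin_three_lie]
    by (simp add: three_lie_coalgebra_sel three_lie_tri_def)
qed

section \<open>Verification for the operation of a 3-Lie algebra\<close>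

lemma primitive_three_lie: "primitive_coalgebra K X (\<one>\<^bsub>K\<^esub>, \<zero>\<^bsub>L\<^esub>) (\<lambda>v. (\<zero>\<^bsub>K\<^esub>, snd v))"
proof -
  interpret X: module K X by (rule module_three_lie_coalgebra)
  show ?thesis
    by unfold_locales
      (auto intro!: module_homI simp: three_lie_coalgebra_sel three_lie_comult self_module_def)
qed

lemma primitive_tsd_three_lie:
  assumes "is_three_lie_op K L br T"
  shows "primitive_tsd K X (\<one>\<^bsub>K\<^esub>, \<zero>\<^bsub>L\<^esub>) (\<lambda>v. (\<zero>\<^bsub>K\<^esub>, snd v)) T"
proof -
  interpret X: primitive_coalgebra K X "(\<one>\<^bsub>K\<^esub>, \<zero>\<^bsub>L\<^esub>)" "\<lambda>v. (\<zero>\<^bsub>K\<^esub>, snd v)"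
    by (rule primitive_three_lie)
  have T: "T (tens3 K X u v w) = three_lie_tri u v w"
    if "u \<in> carrier X" "v \<in> carrier X" "w \<in> carrier X" for u v w
    using assms that unfolding is_three_lie_op_def Let_def
    by (cases u; cases v; cases w) (simp add: three_lie_coalgebra_sel three_lie_tri_def)
  have mem: "three_lie_tri u v w \<in> carrier X"
    if "u \<in> carrier X" "v \<in> carrier X" "w \<in> carrier X" for u v w
    using that by (auto simp: three_lie_coalgebra_sel three_lie_tri_def br_closed)
  note S = T mem three_lie_coalgebra_sel three_lie_tri_def br_closed br_zero1 br_zero2 br_zero3
  note lin = module_hom_add[OF linear1] module_hom_smult[OF linear1]
  let ?i = "(\<one>\<^bsub>K\<^esub>, \<zero>\<^bsub>L\<^esub>)" and ?p = "\<lambda>v. (\<zero>\<^bsub>K\<^esub>, snd v)"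
  show ?thesis
  proof
    show "T \<in> module_hom K (tensor3 K X) X"
      using assms by (simp add: is_three_lie_op_def Let_def)
  next
    fix x assume "x \<in> carrier X"
    then show "T (tens3 K X x ?i ?i) = x"
      by (cases x) (simp add: S)
  next
    fix x z assume "x \<in> carrier X" "z \<in> carrier X"
    then show "T (tens3 K X x ?i (?p z)) = \<zero>\<^bsub>X\<^esub>"
      by (cases x; cases z) (simp add: S)
  next
    fix x y assume "x \<in> carrier X" "y \<in> carrier X"
    then show "T (tens3 K X x (?p y) ?i) = \<zero>\<^bsub>X\<^esub>"
      by (cases x; cases y) (simp add: S)
  next
    fix y z assume "y \<in> carrier X" "z \<in> carrier X"
    then show "T (tens3 K X ?i y z) = (counit X y \<otimes>\<^bsub>K\<^esub> counit X z) \<odot>\<^bsub>X\<^esub> ?i"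
      by (cases y; cases z) (simp add: S)
  next
    fix x y z assume "x \<in> carrier X" "y \<in> carrier X" "z \<in> carrier X"
    then show "?p (T (tens3 K X x y z)) =
        (counit X y \<otimes>\<^bsub>K\<^esub> counit X z) \<odot>\<^bsub>X\<^esub> ?p x \<oplus>\<^bsub>X\<^esub> T (tens3 K X (?p x) (?p y) (?p z))"
      by (cases x; cases y; cases z) (simp add: S)
  next
    fix x y z assume "x \<in> carrier X" "y \<in> carrier X" "z \<in> carrier X"
    then show "counit X (T (tens3 K X x y z)) = counit X x \<otimes>\<^bsub>K\<^esub> counit X y \<otimes>\<^bsub>K\<^esub> counit X z"
      by (cases x; cases y; cases z) (simp add: S)
  next
    fix x y z u v
    assume *: "x \<in> carrier X" "y \<in> carrier X" "z \<in> carrier X" "u \<in> carrier X" "v \<in> carrier X"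
    obtain a x' b y' c z' d u' e v'
      where eq: "x = (a, x')" "y = (b, y')" "z = (c, z')" "u = (d, u')" "v = (e, v')"
      and K: "a \<in> carrier K" "b \<in> carrier K" "c \<in> carrier K" "d \<in> carrier K" "e \<in> carrier K"
      and L: "x' \<in> carrier L" "y' \<in> carrier L" "z' \<in> carrier L" "u' \<in> carrier L" "v' \<in> carrier L"
      using * by (auto simp: three_lie_coalgebra_sel)
    \<comment> \<open>In the last two summands \<open>?p u\<close> and \<open>?p v\<close> have
      scalar part zero, which leaves just the nested brackets [x,[y,u,v],z] and [x,y,[z,u,v]]. The
      terms with at most one bracket are the same on the left and in the first summand, and the
      fundamental identity matches the double brackets.\<close>
    show "T (tens3 K X (T (tens3 K X x y z)) u v) =
      T (tens3 K X (T (tens3 K X x u v)) y z) \<oplus>\<^bsub>X\<^esub> T (tens3 K X x (T (tens3 K X y (?p u) (?p v))) z)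
        \<oplus>\<^bsub>X\<^esub> T (tens3 K X x y (T (tens3 K X z (?p u) (?p v))))"
      using K L
      by (simp add: eq S lin fundamental_identity[OF L] smult_r_distr smult_assoc1[symmetric]
          R.m_ac M.a_ac)
  next
    fix x y z assume *: "x \<in> carrier X" "y \<in> carrier X" "z \<in> carrier X"
    obtain a x' b y' c z' where eq: "x = (a, x')" "y = (b, y')" "z = (c, z')"
      and K: "a \<in> carrier K" "b \<in> carrier K" "c \<in> carrier K"
      and L: "x' \<in> carrier L" "y' \<in> carrier L" "z' \<in> carrier L"
      using * by (auto simp: three_lie_coalgebra_sel)
    \<comment> \<open>The first term contributes the bracket [x,z,y] and the second is [x,y,z] with
      scalar part zero; the two brackets cancel.\<close>
    show "T (tens3 K X x z y) \<oplus>\<^bsub>X\<^esub> T (tens3 K X x (?p y) (?p z)) =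
        (counit X y \<otimes>\<^bsub>K\<^esub> counit X z) \<odot>\<^bsub>X\<^esub> x"
      using K L by (simp add: eq S br_swap[OF L] R.m_ac M.a_assoc M.l_neg)
  qed
qed

end

theorem lemma4p1:
  fixes K :: "('k, 'r) ring_scheme"
    and L :: "('k, 'l, 'm) module_scheme"
    and br :: "'l \<Rightarrow> 'l \<Rightarrow> 'l \<Rightarrow> 'l"
  assumes "three_lie_algebra K L br"
  shows "(\<exists>T. is_three_lie_op K L br T) \<and>
    (\<forall>T. is_three_lie_op K L br T \<longrightarrow>
       tsd_object K (three_lie_coalgebra K L) T \<and>
       reversible_tsd K (three_lie_coalgebra K L) T)"
proof -
  interpret three_lie_algebra K L br by fact
  show ?thesis
    using three_lie_op_exists primitive_tsd.tsd_object[OF primitive_tsd_three_lie]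
      primitive_tsd.reversible[OF primitive_tsd_three_lie] by blast
qed

end
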